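(* Let $L\subset S^3$ be an oriented link, let $d=\deg_z P_L$ be the maximal $z$-degree of its HOMFLY--PT polynomial $P_L(a,z)$, and assume $d\ge 0$. Let $p_d(a)=[z^d]P_L(a,z)$ be the coefficient of $z^d$ in $P_L(a,z)$, and set $$\mathcal M_d=\{(-1)^q a^{2q-d} : q=0,1,\ldots,d\}.$$ If $L$ admits an ordinary oriented binary skein tree of depth $d$, then $p_d(a)\in\mathcal M_d$. Consequently, $$p_d(a)\notin\mathcal M_d\quad\Longrightarrow\quad \mathrm{td}(L)\ge d+1.$$
   Context: The HOMFLY--PT polynomial $P_L(a,z)\in\mathbb Z[a^{\pm1},z^{\pm1}]$ of oriented links is normalised by $P_U(a,z)=1$ for the unknot $U$ and $$a\,P_{L_+}(a,z)-a^{-1}P_{L_-}(a,z)=z\,P_{L_0}(a,z),$$ where $L_+,L_-,L_0$ are oriented links with diagrams identical except near one crossing, which is positive, negative, and smoothed according to orientation, respectively. Thus the $r$-component unlink has polynomial $((a-a^{-1})/z)^{r-1}$. An ordinary oriented binary skein tree for $L$ has a diagram of $L$ at its root and unlink diagrams (of any number $r\ge1$ of components) at its leaves. At each internal vertex a crossing of the current oriented diagram is chosen; one child is obtained by switching that crossing and the other by its oriented smoothing. Reidemeister moves and diagram isotopies may be made without cost between resolutions. The depth of the tree is the maximum number of edges in a root-to-leaf path, counting both switching and smoothing edges. The skein tree depth $\mathrm{td}(L)$ is the minimum of this depth over all such trees and all diagrams of $L$. *)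

theory Defs
  imports
    "HOL-Analysis.Analysis"
    "HOL-Library.Poly_Mapping"
    "HOL-Library.Product_Plus"
    "HOL-Library.Extended_Nat"
begin

section \<open>Laurent polynomials\<close>

text \<open>
  The ring of integer Laurent polynomials in \<open>a\<close>, \<open>z\<close> is the group ring of \<open>\<int> \<times> \<int>\<close>:
  the key \<open>(i, j)\<close> stands for the monomial \<open>a\<^sup>i z\<^sup>j\<close>, and multiplication is convolution.
\<close>

type_synonym laurent_a = "int \<Rightarrow>\<^sub>0 int"
type_synonym laurent_az = "(int \<times> int) \<Rightarrow>\<^sub>0 int"

definition monom_az :: "int \<Rightarrow> int \<Rightarrow> laurent_az" where
  "monom_az i j = Poly_Mapping.single (i, j) 1"

definition z_coeff :: "int \<Rightarrow> laurent_az \<Rightarrow> laurent_a" where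
  "z_coeff d p = Poly_Mapping.map_key (\<lambda>i. (i, d)) p"

text \<open>\<open>d\<close> is the maximal \<open>z\<close>-degree of \<open>p\<close>; the zero polynomial has no \<open>z\<close>-degree.\<close>

definition is_z_degree :: "laurent_az \<Rightarrow> int \<Rightarrow> bool" where
  "is_z_degree p d \<longleftrightarrow>
     d \<in> snd ` Poly_Mapping.keys p \<and> (\<forall>j \<in> snd ` Poly_Mapping.keys p. j \<le> d)"

definition M_set :: "nat \<Rightarrow> laurent_a set" where
  "M_set d = {Poly_Mapping.single (2 * int q - int d) ((-1) ^ q) | q. q \<in> {0..d}}"


section \<open>Oriented links\<close>

text \<open>
  Tame oriented links are represented by oriented polygonal links. A link in the
  3-sphere misses a point, so it is placed in 3-space, which is written as
  (plane \<open>\<times>\<close> height): \<open>fst\<close> is the projection to the plane in which diagrams are drawn and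
  \<open>snd\<close> is the height over it. A link is given by its finite set of directed edges
  \<open>(tail, head)\<close>. Every vertex is the tail of exactly one edge and the head of
  exactly one edge, so the edges form disjoint directed closed polygons.
\<close>

type_synonym plane = "real \<times> real"
type_synonym space = "plane \<times> real"
type_synonym link = "(space \<times> space) set"

definition seg :: "'a::real_vector \<times> 'a \<Rightarrow> 'a set" where
  "seg e = closed_segment (fst e) (snd e)"

definition polygonal_link :: "link \<Rightarrow> bool" where
  "polygonal_link L \<longleftrightarrow>
     finite L \<and> L \<noteq> {} \<and>
     (\<forall>(p, q) \<in> L. p \<noteq> q) \<and>
     inj_on fst L \<and> inj_on snd L \<and> fst ` L = snd ` L \<and>
     (\<forall>e \<in> L. \<forall>f \<in> L. e \<noteq> f \<longrightarrow>
        seg e \<inter> seg f \<subseteq> {fst e, snd e} \<inter> {fst f, snd f})"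

text \<open>
  The elementary (triangle) moves of Reidemeister: an edge \<open>AB\<close> is replaced by the path \<open>ACB\<close>
  if the link meets the triangle \<open>ABC\<close> in \<open>AB\<close> only. Subdivision of \<open>AB\<close>
  is the degenerate case where \<open>C\<close> lies on \<open>AB\<close>. The equivalence generated by these moves
  is ambient isotopy of oriented links.
\<close>

definition triangle_move :: "link \<Rightarrow> link \<Rightarrow> bool" where
  "triangle_move L L' \<longleftrightarrow>
     polygonal_link L \<and> polygonal_link L' \<and>
     (\<exists>A B C. (A, B) \<in> L \<and>
        convex hull {A, B, C} \<inter> (\<Union>e \<in> L. seg e) = closed_segment A B \<and>
        L' = L - {(A, B)} \<union> {(A, C), (C, B)})"

definition isotopic :: "link \<Rightarrow> link \<Rightarrow> bool" where
  "isotopic = equivclp triangle_move"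

text \<open>The \<open>r\<close>-component unlink, as \<open>r\<close> triangles side by side in the plane of height 0.\<close>

definition std_unlink :: "nat \<Rightarrow> link" where
  "std_unlink r = (\<Union>i<r.
     let A = ((2 * real i, 0), 0); B = ((2 * real i + 1, 0), 0); C = ((2 * real i, 1), 0)
     in {(A, B), (B, C), (C, A)})"

definition is_unlink :: "nat \<Rightarrow> link \<Rightarrow> bool" where
  "is_unlink r L \<longleftrightarrow> 1 \<le> r \<and> isotopic L (std_unlink r)"


section \<open>Diagrams\<close>

text \<open>
  A diagram is a polygonal link in regular position with respect to the projection \<open>fst\<close>:
  no edge is vertical, no vertex projects into an edge of which it is not an endpoint, and
  there are no triple points. (Two edges then cannot overlap in the projection, so the
  multiple points are finitely many transverse double points.) What one draws is the
  projection \<open>shadow\<close> together with the over/under information \<open>over\<close>.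
\<close>

definition proj :: "space \<times> space \<Rightarrow> plane \<times> plane" where
  "proj e = (fst (fst e), fst (snd e))"

definition is_diagram :: "link \<Rightarrow> bool" where
  "is_diagram D \<longleftrightarrow>
     polygonal_link D \<and>
     (\<forall>(p, q) \<in> D. fst p \<noteq> fst q) \<and>
     (\<forall>v \<in> fst ` D. \<forall>(p, q) \<in> D. fst v \<in> closed_segment (fst p) (fst q) \<longrightarrow> v = p \<or> v = q) \<and>
     (\<forall>e \<in> D. \<forall>f \<in> D. \<forall>g \<in> D. e \<noteq> f \<and> e \<noteq> g \<and> f \<noteq> g \<longrightarrow>
        seg (proj e) \<inter> seg (proj f) \<inter> seg (proj g) = {})"

definition diagram_of :: "link \<Rightarrow> link \<Rightarrow> bool" where
  "diagram_of L D \<longleftrightarrow> is_diagram D \<and> isotopic L D"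

definition shadow :: "link \<Rightarrow> (plane \<times> plane) set" where
  "shadow D = proj ` D"

text \<open>\<open>(e, f) \<in> over D\<close>: there is a crossing at which \<open>e\<close> passes over \<open>f\<close>.\<close>

definition over :: "link \<Rightarrow> ((plane \<times> plane) \<times> (plane \<times> plane)) set" where
  "over D = {(proj e, proj f) | e f. e \<in> D \<and> f \<in> D \<and>
     (\<exists>p \<in> seg e. \<exists>q \<in> seg f. fst p = fst q \<and> snd q < snd p)}"

text \<open>
  Diagram isotopies and Reidemeister moves, in polygonal form: each of them is a sequence of
  triangle moves through regular positions, and conversely every triangle move between
  regular positions projects to a composition of planar isotopies and Reidemeister moves.
\<close>

definition diagram_equiv :: "link \<Rightarrow> link \<Rightarrow> bool" where
  "diagram_equiv = equivclp (\<lambda>D D'. is_diagram D \<and> is_diagram D' \<and> triangle_move D D')"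


section \<open>Skein triples\<close>

text \<open>
  With the over strand in direction \<open>u\<close> and the under strand in direction \<open>v\<close>, a crossing is
  positive iff \<open>(u, v)\<close> is a positively oriented basis of the plane.
\<close>

definition positive_crossing :: "plane \<times> plane \<Rightarrow> plane \<times> plane \<Rightarrow> bool" where
  "positive_crossing e f \<longleftrightarrow>
     (let u = snd e - fst e; v = snd f - fst f in fst u * snd v - snd u * fst v > 0)"

text \<open>
  The crossing edges span a quadrilateral that the rest of the diagram meets in its corners
  at most, so that it is a disc isolating the crossing. Every crossing can be brought into
  this form by subdividing the two edges near it.
\<close>

definition isolated :: "(plane \<times> plane) set \<Rightarrow> plane \<times> plane \<Rightarrow> plane \<times> plane \<Rightarrow> bool" where
  "isolated S e f \<longleftrightarrow>
     (\<forall>g \<in> S - {e, f}.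
        convex hull {fst e, snd e, fst f, snd f} \<inter> seg g \<subseteq> {fst e, snd e, fst f, snd f})"

text \<open>
  \<open>Lp\<close>, \<open>Lm\<close>, \<open>L0\<close> are identical except at one crossing, which is positive, negative and
  smoothed, respectively. If \<open>A \<rightarrow> B\<close> and \<open>C \<rightarrow> D\<close> cross, the oriented smoothing
  replaces them by \<open>A \<rightarrow> D\<close> and \<open>C \<rightarrow> B\<close>, which are opposite sides of the quadrilateral.
\<close>

definition skein_triple :: "link \<Rightarrow> link \<Rightarrow> link \<Rightarrow> bool" where
  "skein_triple Lp Lm L0 \<longleftrightarrow>
     is_diagram Lp \<and> is_diagram Lm \<and> is_diagram L0 \<and>
     (\<exists>A B C D. let e = (A, B); f = (C, D) in
        (e, f) \<in> over Lp \<and> positive_crossing e f \<and> isolated (shadow Lp) e f \<and>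
        shadow Lm = shadow Lp \<and>
        over Lm = over Lp - {(e, f)} \<union> {(f, e)} \<and>
        shadow L0 = shadow Lp - {e, f} \<union> {(A, D), (C, B)} \<and>
        over L0 = over Lp - {(e, f)})"

text \<open>\<open>D\<^sub>1\<close> and \<open>D\<^sub>0\<close> arise from \<open>D\<close> by switching and smoothing one crossing of either sign.\<close>

definition resolution :: "link \<Rightarrow> link \<Rightarrow> link \<Rightarrow> bool" where
  "resolution D D\<^sub>1 D\<^sub>0 \<longleftrightarrow> skein_triple D D\<^sub>1 D\<^sub>0 \<or> skein_triple D\<^sub>1 D D\<^sub>0"


section \<open>The HOMFLY--PT polynomial\<close>

text \<open>
  The defining properties of the HOMFLY--PT polynomial: it is an isotopy invariant of oriented
  links, has value 1 on the unknot, and satisfies the skein relation.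
  These conditions determine its values on all polygonal links.
\<close>

definition is_HOMFLY :: "(link \<Rightarrow> laurent_az) \<Rightarrow> bool" where
  "is_HOMFLY P \<longleftrightarrow>
     (\<forall>L L'. polygonal_link L \<and> polygonal_link L' \<and> isotopic L L' \<longrightarrow> P L = P L') \<and>
     (\<forall>U. is_unlink 1 U \<longrightarrow> P U = 1) \<and>
     (\<forall>Lp Lm L0. skein_triple Lp Lm L0 \<longrightarrow>
        monom_az 1 0 * P Lp - monom_az (-1) 0 * P Lm = monom_az 0 1 * P L0)"


section \<open>Skein trees\<close>

datatype skein_tree =
  Leaf link
| Node link skein_tree skein_tree

primrec root :: "skein_tree \<Rightarrow> link" where
  "root (Leaf D) = D"
| "root (Node D S T) = D"

primrec depth :: "skein_tree \<Rightarrow> nat" where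
  "depth (Leaf D) = 0"
| "depth (Node D S T) = Suc (max (depth S) (depth T))"

text \<open>The first child of a node is the switching, the second one the smoothing.\<close>

primrec valid_tree :: "skein_tree \<Rightarrow> bool" where
  "valid_tree (Leaf D) \<longleftrightarrow> is_diagram D \<and> (\<exists>r\<ge>1. is_unlink r D)"
| "valid_tree (Node D S T) \<longleftrightarrow>
     (\<exists>D\<^sub>1 D\<^sub>0. resolution D D\<^sub>1 D\<^sub>0 \<and> diagram_equiv D\<^sub>1 (root S) \<and> diagram_equiv D\<^sub>0 (root T)) \<and>
     valid_tree S \<and> valid_tree T"

definition skein_tree_for :: "link \<Rightarrow> skein_tree \<Rightarrow> bool" where
  "skein_tree_for L T \<longleftrightarrow> valid_tree T \<and> diagram_of L (root T)"

text \<open>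
  The infimum is taken in the extended naturals, where it is the minimum of any nonempty set;
  only the infimum of the empty set would be \<open>\<infinity>\<close>.
\<close>

definition td :: "link \<Rightarrow> enat" where
  "td L = (INF T \<in> {T. skein_tree_for L T}. enat (depth T))"

end

theory Submission
  imports Defs
begin

text \<open>
  Follow the coefficient of the highest conceivable \<open>z\<close>-power down the tree. Solved for the polynomial
  of the diagram at a node, the skein relation reads
  \<open>P D = a\<^sup>\<minus>\<^sup>2 P D\<^sub>1 + a\<^sup>\<minus>\<^sup>1 z P D\<^sub>0\<close> at a positive crossing and
  \<open>P D = a\<^sup>2 P D\<^sub>1 - a z P D\<^sub>0\<close> at a negative one, where \<open>D\<^sub>1\<close> is switched and \<open>D\<^sub>0\<close> smoothed.
  If both subtrees have depth at most \<open>n\<close>, then, inductively, both polynomials have \<open>z\<close>-degree at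
  most \<open>n\<close>, so the coefficient of \<open>z\<close> to the power \<open>n + 1\<close> in \<open>P D\<close> comes from the smoothing alone: it
  is \<open>a\<^sup>\<minus>\<^sup>1\<close> or \<open>- a\<close> times the coefficient of \<open>z\<close> to the power \<open>n\<close> in \<open>P D\<^sub>0\<close>. Multiplication by these
  monomials maps \<open>M_set n\<close> into \<open>M_set (n + 1)\<close>, with \<open>q\<close> counting the negative crossings that were
  smoothed. So in a tree of depth at most \<open>n\<close> the coefficient of \<open>z\<close> to the power \<open>n\<close> at the root is
  zero or lies in \<open>M_set n\<close> (lemma \<open>tree_top_is_monomial\<close>). At depth \<open>d\<close> it is nonzero because \<open>d\<close> is the
  \<open>z\<close>-degree, and a tree of smaller depth is covered as well, which gives the bound on \<open>td\<close>.

  The induction starts at the unlinks, where it has to be known that the unknot contributes 1 and an unlink of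
  several components only negative powers of \<open>z\<close>. The second fact is not among the defining properties
  of the polynomial. It comes from a skein triple whose two crossing diagrams are both \<open>m + 1\<close>-component
  unlinks and whose smoothing is the \<open>m + 2\<close>-component unlink: put a curl into one
  component. Then \<open>(a - a\<^sup>\<minus>\<^sup>1) P U = z P U'\<close> for the two unlinks, so each further component
  lowers the \<open>z\<close>-degree by at least one (lemma \<open>std_unlink_z_degree_at_most\<close>).

  Exhibiting this triple (lemma \<open>unlink_skein\<close>) takes up most of the text, as it has to be done with
  explicit polygons and triangle moves. All moves are instances of one lemma, \<open>insert_vertex\<close>, which
  replaces an edge by two sides of a triangle. The curl is a hexagon obtained from a triangle by three such
  insertions; its smoothing consists of two triangles, one of which is turned over in space by
  lemma \<open>reverse_triangle\<close>. The other components are the standard triangles to the left of the curl; they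
  enter through being polygonal, flat and to the left.
\<close>

section \<open>Polygonal links and triangle moves\<close>

lemma isotopic_trans: "isotopic K L \<Longrightarrow> isotopic L M \<Longrightarrow> isotopic K M"
  unfolding isotopic_def using transp_equivclp by (rule transpD)

lemma isotopic_sym: "isotopic K L \<Longrightarrow> isotopic L K"
  unfolding isotopic_def by (rule equivclp_sym)

definition triangle :: "space \<Rightarrow> space \<Rightarrow> space \<Rightarrow> link" where
  "triangle A B C = {(A, B), (B, C), (C, A)}"

text \<open>
  A linear dependence between the two difference vectors would survive the projection, so it suffices
  to compute a determinant in the plane.
\<close>

lemma noncollinear_shadow:
  fixes A B C :: space
  assumes "(fst (fst B) - fst (fst A)) * (snd (fst C) - snd (fst A))
     \<noteq> (snd (fst B) - snd (fst A)) * (fst (fst C) - fst (fst A))"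
  shows "\<not> collinear {A, B, C}"
proof
  assume "collinear {A, B, C}"
  then obtain u where u: "\<forall>x\<in>{A, B, C}. \<forall>y\<in>{A, B, C}. \<exists>c. x - y = c *\<^sub>R u"
    unfolding collinear_def by blast
  then obtain c d where "B - A = c *\<^sub>R u" "C - A = d *\<^sub>R u" by blast
  then have "fst (fst B) - fst (fst A) = c * fst (fst u)" "snd (fst B) - snd (fst A) = c * snd (fst u)"
     "fst (fst C) - fst (fst A) = d * fst (fst u)" "snd (fst C) - snd (fst A) = d * snd (fst u)"
    by (auto simp: prod_eq_iff)
  with assms show False by simp
qed

lemma triangle_sides_Int:
  fixes A B C :: "'a::euclidean_space"
  assumes "\<not> collinear {A, B, C}"
  shows "seg (A, B) \<inter> seg (B, C) = {B}"
  using Int_closed_segment[of B A C] assms by (simp add: seg_def insert_commute)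

lemma polygonal_Un:
  assumes K: "polygonal_link K" and R: "R = {} \<or> polygonal_link R"
    and d: "\<And>e f. e \<in> K \<Longrightarrow> f \<in> R \<Longrightarrow> seg e \<inter> seg f = {}"
  shows "polygonal_link (K \<union> R)"
proof (cases "R = {}")
  case False
  then have R: "polygonal_link R" using R by blast
  have v: "fst e \<noteq> fst f \<and> snd e \<noteq> snd f" if "e \<in> K" "f \<in> R" for e f
  proof -
    have "fst e \<in> seg e" "fst f \<in> seg f" "snd e \<in> seg e" "snd f \<in> seg f"
      by (auto simp: seg_def)
    then show ?thesis using d[OF that] by (metis IntI empty_iff)
  qed
  have i: "inj_on fst K" "inj_on snd K" "inj_on fst R" "inj_on snd R"
    using K R by (simp_all add: polygonal_link_def)
  have "fst ` (K - R) \<inter> fst ` (R - K) = {}" "snd ` (K - R) \<inter> snd ` (R - K) = {}"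
    using v by blast+
  with i have "inj_on fst (K \<union> R)" "inj_on snd (K \<union> R)"
    by (simp_all add: inj_on_Un)
  moreover have "fst ` (K \<union> R) = snd ` (K \<union> R)"
    using K R by (simp add: polygonal_link_def image_Un)
  moreover have "seg e \<inter> seg f \<subseteq> {fst e, snd e} \<inter> {fst f, snd f}"
    if e: "e \<in> K \<union> R" and f: "f \<in> K \<union> R" and "e \<noteq> f" for e f
  proof -
    consider "e \<in> K" "f \<in> K" | "e \<in> R" "f \<in> R" | "e \<in> K" "f \<in> R" | "e \<in> R" "f \<in> K"
      using e f by blast
    then show ?thesis
    proof cases
      case 1 then show ?thesis using K \<open>e \<noteq> f\<close> by (simp add: polygonal_link_def)
    next
      case 2 then show ?thesis using R \<open>e \<noteq> f\<close> by (simp add: polygonal_link_def)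
    next
      case 3 then show ?thesis by (simp add: d)
    next
      case 4 then show ?thesis using d[of f e] by (simp add: Int_commute)
    qed
  qed
  moreover have "finite (K \<union> R)" "K \<union> R \<noteq> {}" "\<forall>(p, q) \<in> K \<union> R. p \<noteq> q"
    using K R by (auto simp: polygonal_link_def)
  ultimately show ?thesis unfolding polygonal_link_def by simp
qed (use K in simp)

lemma polygonal_triangle:
  assumes "\<not> collinear {A, B, C}"
  shows "polygonal_link (triangle A B C)"
proof -
  have n: "A \<noteq> B" "B \<noteq> C" "A \<noteq> C"
    using assms by (auto simp: insert_commute)
  have "\<not> collinear {B, C, A}" "\<not> collinear {C, A, B}"
    using assms by (simp_all add: insert_commute)
  then have s: "seg (A, B) \<inter> seg (B, C) = {B}" "seg (B, C) \<inter> seg (C, A) = {C}"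
     "seg (C, A) \<inter> seg (A, B) = {A}"
    using assms by (simp_all add: triangle_sides_Int)
  then have s': "seg (B, C) \<inter> seg (A, B) = {B}" "seg (C, A) \<inter> seg (B, C) = {C}"
     "seg (A, B) \<inter> seg (C, A) = {A}"
    by (simp_all only: Int_commute)
  show ?thesis
    unfolding polygonal_link_def triangle_def
  proof (intro conjI)
    show "\<forall>e\<in>{(A, B), (B, C), (C, A)}. \<forall>f\<in>{(A, B), (B, C), (C, A)}. e \<noteq> f \<longrightarrow>
        seg e \<inter> seg f \<subseteq> {fst e, snd e} \<inter> {fst f, snd f}"
      by (simp add: s s')
  qed (use n in auto)
qed

text \<open>
  The elementary move from data that are easy to check: a nondegenerate triangle that the other edges meet at
  most in \<open>A\<close> and \<open>B\<close>. The new link is automatically polygonal. The point \<open>C\<close> is off the link, hence a new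
  vertex; and a new edge lies in the triangle, so it meets an old edge \<open>g\<close> only in a common vertex \<open>A\<close> or \<open>B\<close>,
  where \<open>g\<close> ends in \<open>A\<close> or starts in \<open>B\<close> because the edge \<open>AB\<close> already occupies the other role.
\<close>

lemma insert_vertex:
  assumes L: "polygonal_link L" and e: "(A, B) \<in> L" and nc: "\<not> collinear {A, B, C}"
    and hull: "\<And>g p. g \<in> L - {(A, B)} \<Longrightarrow> p \<in> convex hull {A, B, C} \<Longrightarrow> p \<in> seg g \<Longrightarrow> p = A \<or> p = B"
    and L': "L' = L - {(A, B)} \<union> {(A, C), (C, B)}"
  shows "polygonal_link L' \<and> isotopic L L'"
proof -
  let ?T = "convex hull {A, B, C}"
  have n: "A \<noteq> B" "B \<noteq> C" "A \<noteq> C"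
    using nc by (auto simp: insert_commute)
  have AB: "closed_segment A B \<subseteq> ?T"
    unfolding segment_convex_hull by (rule hull_mono) auto
  have AC: "seg (A, C) \<subseteq> ?T" and CB: "seg (C, B) \<subseteq> ?T"
    unfolding seg_def segment_convex_hull by (rule hull_mono; auto)+
  have touch: "?T \<inter> (\<Union>e\<in>L. seg e) = closed_segment A B"
  proof
    show "?T \<inter> (\<Union>e\<in>L. seg e) \<subseteq> closed_segment A B"
    proof
      fix p assume "p \<in> ?T \<inter> (\<Union>e\<in>L. seg e)"
      then obtain g where g: "g \<in> L" "p \<in> seg g" "p \<in> ?T" by blast
      show "p \<in> closed_segment A B"
      proof (cases "g = (A, B)")
        case True then show ?thesis using g by (simp add: seg_def)
      next
        case False then show ?thesis using hull[of g p] g by auto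
      qed
    qed
    show "closed_segment A B \<subseteq> ?T \<inter> (\<Union>e\<in>L. seg e)"
      using AB e by (force simp: seg_def)
  qed
  have ncs: "\<not> collinear {A, C, B}" "\<not> collinear {C, B, A}" "\<not> collinear {B, A, C}"
    using nc by (simp_all add: insert_commute)
  have ACB: "seg (A, C) \<inter> seg (C, B) = {C}"
    by (rule triangle_sides_Int[OF ncs(1)])
  have "A \<in> seg (A, C)" "B \<in> seg (C, B)" by (simp_all add: seg_def)
  then have nB: "B \<notin> seg (A, C)" and nA: "A \<notin> seg (C, B)"
    using ACB n by blast+
  have C: "C \<notin> seg g" if g: "g \<in> L" for g
  proof
    assume "C \<in> seg g"
    then have "C \<in> closed_segment A B"
      using touch g hull_inc[of C "{A, B, C}"] by blast
    then have "C \<in> seg (A, B)" by (simp add: seg_def)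
    moreover have "C \<in> seg (B, C)" by (simp add: seg_def)
    ultimately show False using n triangle_sides_Int[OF nc] by (metis IntI singletonD)
  qed
  have vx: "fst g \<in> seg g" "snd g \<in> seg g" for g :: "space \<times> space" by (auto simp: seg_def)
  have Cv: "C \<noteq> fst g \<and> C \<noteq> snd g" if "g \<in> L" for g
    using C[OF that] vx[of g] by auto
  have inj: "inj_on fst L" "inj_on snd L" using L by (simp_all add: polygonal_link_def)
  have A: "fst g \<noteq> A" "snd g \<noteq> B" if "g \<in> L - {(A, B)}" for g
    using that e inj_onD[OF inj(1), of g "(A, B)"] inj_onD[OF inj(2), of g "(A, B)"] by auto
  have ends: "p = A \<and> p = snd g \<or> p = B \<and> p = fst g"
    if g: "g \<in> L - {(A, B)}" "p \<in> ?T" "p \<in> seg g" for g p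
  proof -
    have "p = A \<or> p = B" using hull g by blast
    moreover have "p \<in> seg (A, B)" using calculation by (auto simp: seg_def)
    then have "p \<in> {fst g, snd g}" using L e g unfolding polygonal_link_def by fastforce
    ultimately show ?thesis using A[OF g(1)] by auto
  qed
  have 1: "seg (A, C) \<inter> seg g \<subseteq> {A} \<inter> {snd g}" if "g \<in> L - {(A, B)}" for g
    using ends[OF that] AC nB by blast
  have 2: "seg (C, B) \<inter> seg g \<subseteq> {B} \<inter> {fst g}" if "g \<in> L - {(A, B)}" for g
    using ends[OF that] CB nA by blast
  have "polygonal_link L'"
    unfolding polygonal_link_def
  proof (intro conjI)
    show "finite L'" "L' \<noteq> {}" using L by (auto simp: L' polygonal_link_def)
    show "\<forall>(p, q)\<in>L'. p \<noteq> q" using L n by (auto simp: L' polygonal_link_def)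
    have i: "inj_on fst (L - {(A, B)})" "inj_on snd (L - {(A, B)})"
      using inj by (blast intro: inj_on_subset)+
    show "inj_on fst L'"
      unfolding L' using i(1) A(1) Cv n by (auto simp: inj_on_Un) (fastforce+)?
    show "inj_on snd L'"
      unfolding L' using i(2) A(2) Cv n by (auto simp: inj_on_Un) (fastforce+)?
    have "fst ` (L - {(A, B)}) = fst ` L - {A}" "snd ` (L - {(A, B)}) = snd ` L - {B}"
      using inj_on_image_set_diff[OF inj(1), of L "{(A, B)}"]
        inj_on_image_set_diff[OF inj(2), of L "{(A, B)}"] e by simp_all
    moreover have "A \<in> fst ` L" "B \<in> snd ` L"
      using imageI[OF e, of fst] imageI[OF e, of snd] by simp_all
    moreover have "fst ` L = snd ` L" using L by (simp add: polygonal_link_def)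
    moreover have "V - {A} \<union> {A, C} = V - {B} \<union> {C, B}" if "A \<in> V" "B \<in> V" for V
      using that by blast
    ultimately show "fst ` L' = snd ` L'"
      unfolding L' image_Un image_insert image_empty fst_conv snd_conv by metis
    show "\<forall>e\<in>L'. \<forall>f\<in>L'. e \<noteq> f \<longrightarrow> seg e \<inter> seg f \<subseteq> {fst e, snd e} \<inter> {fst f, snd f}"
    proof (intro ballI impI)
      fix g h assume g: "g \<in> L'" and h: "h \<in> L'" and gh: "g \<noteq> h"
      consider "g \<in> L - {(A, B)}" "h \<in> L - {(A, B)}"
        | "g \<in> L - {(A, B)}" "h = (A, C)" | "g \<in> L - {(A, B)}" "h = (C, B)"
        | "h \<in> L - {(A, B)}" "g = (A, C)" | "h \<in> L - {(A, B)}" "g = (C, B)"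
        | "g = (A, C)" "h = (C, B)" | "g = (C, B)" "h = (A, C)"
        using g h gh unfolding L' by blast
      then show "seg g \<inter> seg h \<subseteq> {fst g, snd g} \<inter> {fst h, snd h}"
      proof cases
        case 1 then show ?thesis using L gh by (simp add: polygonal_link_def)
      next
        case 2 then show ?thesis using 1[of g] by auto
      next
        case 3 then show ?thesis using 2[of g] by auto
      next
        case 4 then show ?thesis using 1[of h] by auto
      next
        case 5 then show ?thesis using 2[of h] by auto
      next
        case 6 then show ?thesis using ACB by auto
      next
        case 7 then show ?thesis using ACB by auto
      qed
    qed
  qed
  moreover have "triangle_move L L'"
    unfolding triangle_move_def using L calculation e touch L' by blast
  ultimately show ?thesis by (auto simp: isotopic_def)
qed

lemma polygonal_triangle_Un:
  assumes "\<not> collinear {A, B, C}" and R: "R = {} \<or> polygonal_link R"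
    and d: "\<And>f. f \<in> R \<Longrightarrow> convex hull {A, B, C} \<inter> seg f = {}"
  shows "polygonal_link (triangle A B C \<union> R)"
proof (rule polygonal_Un[OF polygonal_triangle[OF assms(1)] R])
  fix e f assume e: "e \<in> triangle A B C" and f: "f \<in> R"
  have "seg e \<subseteq> convex hull {A, B, C}"
    unfolding seg_def segment_convex_hull using e
    by (intro hull_mono) (auto simp: triangle_def)
  then show "seg e \<inter> seg f = {}" using d[OF f] by blast
qed

text \<open>
  Let \<open>ABC\<close> and \<open>ABD\<close> be two faces of a tetrahedron. Both triangles turn into the skew quadrilateral
  \<open>ABDC\<close> by inserting one vertex. The faces of a tetrahedron intersect in the faces spanned by their common
  vertices, so the triangles of the two moves meet the polygon in the right edge only.
\<close>

lemma replace_corner: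
  assumes ind: "\<not> affine_dependent {A, B, C, D}" "distinct [A, B, C, D]"
    and R: "R = {} \<or> polygonal_link R"
    and d: "\<And>f. f \<in> R \<Longrightarrow> convex hull {A, B, C, D} \<inter> seg f = {}"
  shows "isotopic (triangle A B C \<union> R) (triangle A B D \<union> R)"
proof -
  have nc: "\<not> collinear {X, Y, Z}"
    if "{X, Y, Z} \<subseteq> {A, B, C, D}" "distinct [X, Y, Z]" for X Y Z
    using that affine_independent_subset[OF ind(1)] by (auto simp: collinear_3_eq_affine_dependent)
  have meet: "p \<in> convex hull (S \<inter> T)" if "S \<union> T \<subseteq> {A, B, C, D}" "p \<in> convex hull S" "p \<in> convex hull T" for S T p
    using convex_hull_Int_subset[of S T] affine_independent_subset[OF ind(1) that(1)] that by blast
  have dR: "f \<notin> R" if "fst f \<in> {A, B, C, D}" for f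
    using d[of f] that hull_inc[of "fst f" "{A, B, C, D}"] by (auto simp: seg_def)
  have dT: "convex hull V \<inter> seg f = {}" if "V \<subseteq> {A, B, C, D}" "f \<in> R" for f V
    using d[OF that(2)] hull_mono[OF that(1)] by blast
  let ?Q = "{(A, B), (B, D), (D, C), (C, A)} \<union> R"
  have 1: "isotopic (triangle A B C \<union> R) ?Q"
  proof (rule conjunct2, rule insert_vertex[where A = B and B = C and C = D])
    show "polygonal_link (triangle A B C \<union> R)"
      by (rule polygonal_triangle_Un[OF nc R]) (use ind dT in auto)
    show "(B, C) \<in> triangle A B C \<union> R" by (simp add: triangle_def)
    show "\<not> collinear {B, C, D}" using ind by (intro nc) auto
    show "?Q = triangle A B C \<union> R - {(B, C)} \<union> {(B, D), (D, C)}"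
      using ind dR[of "(B, C)"] by (auto simp: triangle_def)
    fix g p assume g: "g \<in> triangle A B C \<union> R - {(B, C)}" and p: "p \<in> convex hull {B, C, D}" "p \<in> seg g"
    then have "g = (A, B) \<or> g = (C, A)" using dT[of "{B, C, D}" g] by (auto simp: triangle_def)
    then show "p = B \<or> p = C"
      using p meet[of "{B, C, D}" "{A, B}" p] meet[of "{B, C, D}" "{C, A}" p] ind
      by (auto simp: seg_def segment_convex_hull)
  qed
  have 2: "isotopic (triangle A B D \<union> R) ?Q"
  proof (rule conjunct2, rule insert_vertex[where A = D and B = A and C = C])
    show "polygonal_link (triangle A B D \<union> R)"
      by (rule polygonal_triangle_Un[OF nc R]) (use ind dT in auto)
    show "(D, A) \<in> triangle A B D \<union> R" by (simp add: triangle_def)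
    show "\<not> collinear {D, A, C}" using ind by (intro nc) auto
    show "?Q = triangle A B D \<union> R - {(D, A)} \<union> {(D, C), (C, A)}"
      using ind dR[of "(D, A)"] by (auto simp: triangle_def)
    fix g p assume g: "g \<in> triangle A B D \<union> R - {(D, A)}" and p: "p \<in> convex hull {D, A, C}" "p \<in> seg g"
    then have "g = (A, B) \<or> g = (B, D)" using dT[of "{D, A, C}" g] by (auto simp: triangle_def)
    then show "p = D \<or> p = A"
      using p meet[of "{D, A, C}" "{A, B}" p] meet[of "{D, A, C}" "{B, D}" p] ind
      by (auto simp: seg_def segment_convex_hull)
  qed
  show ?thesis using 1 2 isotopic_sym isotopic_trans by blast
qed

text \<open>
  The orientation of a triangle is reversed by exchanging two of its corners, with the apex \<open>D\<close> as the free
  place: \<open>ABC\<close>, \<open>ABD\<close>, \<open>ACD\<close>, \<open>ACB\<close>.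
\<close>

lemma reverse_triangle:
  assumes ind: "\<not> affine_dependent {A, B, C, D}" "distinct [A, B, C, D]"
    and R: "R = {} \<or> polygonal_link R"
    and d: "\<And>f. f \<in> R \<Longrightarrow> convex hull {A, B, C, D} \<inter> seg f = {}"
  shows "isotopic (triangle A B C \<union> R) (triangle A C B \<union> R)"
proof -
  have rot: "triangle D A B = triangle A B D" "triangle D A C = triangle A C D"
    by (auto simp: triangle_def)
  have 1: "isotopic (triangle A B C \<union> R) (triangle A B D \<union> R)"
    by (rule replace_corner) (use assms in auto)
  have 2: "isotopic (triangle D A B \<union> R) (triangle D A C \<union> R)"
    by (rule replace_corner) (use assms in \<open>auto simp: insert_commute\<close>)
  have 3: "isotopic (triangle A C D \<union> R) (triangle A C B \<union> R)"
    by (rule replace_corner) (use assms in \<open>auto simp: insert_commute\<close>)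
  show ?thesis
    using isotopic_trans[OF isotopic_trans[OF 1 2[unfolded rot]] 3] .
qed

section \<open>Regular position and crossings\<close>

text \<open>
  The conditions on a diagram beyond being a polygonal link. They are separated out, and stated through the
  projected edges, since they can be checked componentwise when the shadows of the components are disjoint.
\<close>

definition regular_position :: "link \<Rightarrow> bool" where
  "regular_position D \<longleftrightarrow>
     (\<forall>e \<in> D. fst (fst e) \<noteq> fst (snd e)) \<and>
     (\<forall>e \<in> D. \<forall>f \<in> D. fst (fst e) \<in> seg (proj f) \<longrightarrow> fst e = fst f \<or> fst e = snd f) \<and>
     (\<forall>e \<in> D. \<forall>f \<in> D. \<forall>g \<in> D. e \<noteq> f \<and> e \<noteq> g \<and> f \<noteq> g \<longrightarrow>
        seg (proj e) \<inter> seg (proj f) \<inter> seg (proj g) = {})"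

lemma is_diagram_iff: "is_diagram D \<longleftrightarrow> polygonal_link D \<and> regular_position D"
  by (simp add: is_diagram_def regular_position_def split_beta seg_def proj_def)

lemma regular_position_Un:
  assumes K: "regular_position K" and R: "regular_position R"
    and sep: "\<forall>e\<in>K. \<forall>f\<in>R. seg (proj e) \<inter> seg (proj f) = {}"
  shows "regular_position (K \<union> R)"
proof -
  have d: "seg (proj e) \<inter> seg (proj f) = {}" if "e \<in> K" "f \<in> R" for e f
    using sep that by blast
  have v: "fst (fst e) \<in> seg (proj e)" for e by (simp add: seg_def proj_def)
  have 1: "fst e = fst f \<or> fst e = snd f"
    if e: "e \<in> K \<union> R" and f: "f \<in> K \<union> R" and m: "fst (fst e) \<in> seg (proj f)" for e f
  proof -
    consider "e \<in> K" "f \<in> K" | "e \<in> R" "f \<in> R" | "e \<in> K" "f \<in> R" | "e \<in> R" "f \<in> K"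
      using e f by blast
    then show ?thesis
    proof cases
      case 1 then show ?thesis using K m by (simp add: regular_position_def)
    next
      case 2 then show ?thesis using R m by (simp add: regular_position_def)
    next
      case 3 then show ?thesis using d[of e f] m v[of e] by blast
    next
      case 4 then show ?thesis using d[of f e] m v[of e] by blast
    qed
  qed
  have 2: "seg (proj e) \<inter> seg (proj f) \<inter> seg (proj g) = {}"
    if e: "e \<in> K \<union> R" and f: "f \<in> K \<union> R" and g: "g \<in> K \<union> R"
      and n: "e \<noteq> f \<and> e \<noteq> g \<and> f \<noteq> g" for e f g
  proof -
    consider "e \<in> K" "f \<in> K" "g \<in> K" | "e \<in> R" "f \<in> R" "g \<in> R"
      | "e \<in> K" "f \<in> R" | "e \<in> K" "g \<in> R" | "f \<in> K" "g \<in> R"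
      | "e \<in> R" "f \<in> K" | "e \<in> R" "g \<in> K" | "f \<in> R" "g \<in> K"
      using e f g by blast
    then show ?thesis
    proof cases
      case 1 then show ?thesis using K n by (simp add: regular_position_def)
    next
      case 2 then show ?thesis using R n by (simp add: regular_position_def)
    qed (use d in blast)+
  qed
  have 3: "fst (fst e) \<noteq> fst (snd e)" if "e \<in> K \<union> R" for e
    using that K R unfolding regular_position_def by (elim UnE) simp_all
  show ?thesis
    unfolding regular_position_def using 1 2 3 by simp
qed

lemma seg_snd_eq:
  assumes "snd (fst e) = c" "snd (snd e) = c" "(p :: space) \<in> seg e" shows "snd p = c"
  using assms closed_segment_linear_image[OF bounded_linear.linear[OF bounded_linear_snd], of "fst e" "snd e"]
  by (auto simp: seg_def)

lemma seg_proj: "seg (proj e) = fst ` seg e"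
  unfolding seg_def proj_def fst_conv snd_conv
  by (rule closed_segment_linear_image[OF bounded_linear.linear[OF bounded_linear_fst]])

definition flat :: "link \<Rightarrow> bool" where
  "flat L \<longleftrightarrow> (\<forall>e \<in> L. snd (fst e) = 0 \<and> snd (snd e) = 0)"

lemma flat_seg: "flat L \<Longrightarrow> e \<in> L \<Longrightarrow> p \<in> seg e \<Longrightarrow> snd p = 0"
  using seg_snd_eq[of e 0 p] by (simp add: flat_def)

text \<open>
  At constant height the projection is injective on the link. Distinct projected edges therefore meet in common
  end points only, and a vertex belongs to just two edges.
\<close>

lemma flat_regular_position:
  assumes L: "polygonal_link L" and fl: "flat L"
  shows "regular_position L"
proof -
  have lift: "(x, 0) \<in> seg e" if e: "e \<in> L" and x: "x \<in> seg (proj e)" for e x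
  proof -
    obtain p where p: "p \<in> seg e" "x = fst p" using x unfolding seg_proj by blast
    then have "p = (x, 0)" using flat_seg[OF fl e] by (simp add: prod_eq_iff)
    then show ?thesis using p by simp
  qed
  have i: "inj_on fst L" "inj_on snd L" and n: "\<And>e. e \<in> L \<Longrightarrow> fst e \<noteq> snd e"
    using L by (auto simp: polygonal_link_def)
  have m: "p \<in> {fst e, snd e} \<inter> {fst f, snd f}"
    if "e \<in> L" "f \<in> L" "e \<noteq> f" "p \<in> seg e" "p \<in> seg f" for e f p
  proof -
    have "seg e \<inter> seg f \<subseteq> {fst e, snd e} \<inter> {fst f, snd f}"
      using L that by (simp add: polygonal_link_def)
    then show ?thesis using that(4,5) by blast
  qed
  have f0: "snd (fst e) = 0" "snd (snd e) = 0" if "e \<in> L" for e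
    using fl that by (auto simp: flat_def)
  have 1: "fst (fst e) \<noteq> fst (snd e)" if "e \<in> L" for e
    using n[OF that] f0[OF that] by (auto simp: prod_eq_iff)
  have 2: "fst e = fst f \<or> fst e = snd f" if "e \<in> L" "f \<in> L" "fst (fst e) \<in> seg (proj f)" for e f
  proof -
    have "fst e = (fst (fst e), 0)" using f0[OF that(1)] by (simp add: prod_eq_iff)
    then have "fst e \<in> seg f" using lift[OF that(2,3)] by simp
    moreover have "fst e \<in> seg e" by (simp add: seg_def)
    ultimately show ?thesis using m[of e f "fst e"] that by (cases "e = f") auto
  qed
  have triple: False
    if "e \<in> L" "f \<in> L" "g \<in> L" "e \<noteq> f" "e \<noteq> g" "f \<noteq> g" and q: "q \<in> seg (proj e)" "q \<in> seg (proj f)" "q \<in> seg (proj g)" for e f g q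
  proof -
    have p: "(q, 0) \<in> seg e" "(q, 0) \<in> seg f" "(q, 0) \<in> seg g"
      using q that(1-3) by (simp_all add: lift)
    have "(q, 0) = fst e \<or> (q, 0) = snd e" "(q, 0) = fst f \<or> (q, 0) = snd f" "(q, 0) = fst g \<or> (q, 0) = snd g"
      using m[OF that(1,2,4) p(1,2)] m[OF that(1,3,5) p(1,3)] by simp_all
    then have "(fst e = fst f \<or> fst e = fst g \<or> fst f = fst g) \<or> (snd e = snd f \<or> snd e = snd g \<or> snd f = snd g)"
      by metis
    then show False
      using inj_onD[OF i(1)] inj_onD[OF i(2)] that(1-6) by blast
  qed
  have 3: "seg (proj e) \<inter> seg (proj f) \<inter> seg (proj g) = {}"
    if "e \<in> L" "f \<in> L" "g \<in> L" "e \<noteq> f \<and> e \<noteq> g \<and> f \<noteq> g" for e f g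
    using triple[OF that(1-3)] that(4) by blast
  show ?thesis
    unfolding regular_position_def using 1 2 3 by simp
qed

lemma flat_over:
  assumes "flat L"
  shows "over L = {}"
proof -
  have "\<not> snd q < snd p" if "e \<in> L" "f \<in> L" "p \<in> seg e" "q \<in> seg f" for e f p q
    using flat_seg[OF assms that(1,3)] flat_seg[OF assms that(2,4)] by simp
  then show ?thesis unfolding over_def by blast
qed

lemma over_Un:
  assumes "\<forall>e\<in>K. \<forall>f\<in>R. seg (proj e) \<inter> seg (proj f) = {}"
  shows "over (K \<union> R) = over K \<union> over R"
proof
  have sep: False if "e \<in> K" "f \<in> R" "p \<in> seg e" "q \<in> seg f" "fst p = fst q" for e f p q
  proof -
    have "fst p \<in> seg (proj e)" "fst p \<in> seg (proj f)"
      unfolding seg_proj using imageI[OF that(3), of fst] imageI[OF that(4), of fst] that(5) by simp_all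
    then show False using assms that(1,2) by blast
  qed
  show "over (K \<union> R) \<subseteq> over K \<union> over R"
  proof
    fix x assume "x \<in> over (K \<union> R)"
    then obtain e f p q where x: "x = (proj e, proj f)" "e \<in> K \<union> R" "f \<in> K \<union> R"
      "p \<in> seg e" "q \<in> seg f" "fst p = fst q" "snd q < snd p"
      unfolding over_def by blast
    then have "e \<in> K \<and> f \<in> K \<or> e \<in> R \<and> f \<in> R"
      using sep[of e f p q] sep[of f e q p] by auto
    then show "x \<in> over K \<union> over R"
      using x unfolding over_def by blast
  qed
  show "over K \<union> over R \<subseteq> over (K \<union> R)"
    unfolding over_def by blast
qed

section \<open>Coordinates on segments and convex hulls\<close>

text \<open>
  Linear inequalities pass from points to their convex hull. All separation arguments below are instances, with
  the coefficients of the inequality given explicitly.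
\<close>

lemma hull_halfspace:
  fixes p :: space
  assumes "p \<in> convex hull V" "\<forall>v\<in>V. a * fst (fst v) + b * snd (fst v) + c * snd v \<le> d"
  shows "a * fst (fst p) + b * snd (fst p) + c * snd p \<le> d"
proof -
  have i: "inner ((a, b), c) v = a * fst (fst v) + b * snd (fst v) + c * snd v" for v :: space
    by (simp add: inner_prod_def)
  have "convex hull V \<subseteq> {v. inner ((a, b), c) v \<le> d}"
  proof (rule hull_minimal)
    show "V \<subseteq> {v. inner ((a, b), c) v \<le> d}" using assms(2) unfolding i by blast
  qed (rule convex_halfspace_le)
  then show ?thesis using assms(1) unfolding i by blast
qed

lemma plane_hull_halfspace:
  fixes p :: plane
  assumes "p \<in> convex hull V" "\<forall>v\<in>V. a * fst v + b * snd v \<le> d"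
  shows "a * fst p + b * snd p \<le> d"
proof -
  have i: "inner (a, b) v = a * fst v + b * snd v" for v :: plane
    by (simp add: inner_prod_def)
  have "convex hull V \<subseteq> {v. inner (a, b) v \<le> d}"
  proof (rule hull_minimal)
    show "V \<subseteq> {v. inner (a, b) v \<le> d}" using assms(2) unfolding i by blast
  qed (rule convex_halfspace_le)
  then show ?thesis using assms(1) unfolding i by blast
qed

lemma mem_plane_seg:
  "q \<in> seg (v, w) \<longleftrightarrow> (\<exists>u. 0 \<le> u \<and> u \<le> 1 \<and>
     fst q = fst v + u * (fst w - fst v) \<and> snd q = snd v + u * (snd w - snd v))"
  for q :: plane
  by (auto simp: seg_def closed_segment_def prod_eq_iff algebra_simps)

lemma mem_space_seg:
  "p \<in> seg (v, w) \<longleftrightarrow> (\<exists>u. 0 \<le> u \<and> u \<le> 1 \<and>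
     fst (fst p) = fst (fst v) + u * (fst (fst w) - fst (fst v)) \<and>
     snd (fst p) = snd (fst v) + u * (snd (fst w) - snd (fst v)) \<and>
     snd p = snd v + u * (snd w - snd v))"
  for p :: space
  by (auto simp: seg_def closed_segment_def prod_eq_iff algebra_simps)

section \<open>A curl with a positive or a negative crossing\<close>

text \<open>
  The corners of the curl, for a parameter \<open>t\<close> that shifts it along the first axis. Seen from above, with the
  edge \<open>AB\<close> crossing the edge \<open>CD\<close>:

    \<open>D = (0, 1)\<close>, \<open>B = (2, 1)\<close>,

    \<open>F = (0, 0)\<close>, \<open>A = (1, 0)\<close>, \<open>C = (2, 0)\<close>, \<open>E = (3, 0)\<close>.

  The hexagon runs through \<open>F, A, B, E, C, D\<close> in this order. All corners but \<open>B\<close> have height \<open>0\<close>, so the sign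
  of the height \<open>h\<close> of \<open>B\<close> decides which strand is on top. Smoothing the crossing replaces \<open>AB\<close> and \<open>CD\<close> by
  \<open>AD\<close> and \<open>CB\<close>; this leaves the triangles \<open>FAD\<close> and \<open>CBE\<close>, which are two neighbouring
  triangles of the standard unlink, the second one with reversed orientation.
\<close>

definition vF :: "real \<Rightarrow> space" where "vF t = ((t, 0), 0)"
definition vA :: "real \<Rightarrow> space" where "vA t = ((t + 1, 0), 0)"
definition vD :: "real \<Rightarrow> space" where "vD t = ((t, 1), 0)"
definition vC :: "real \<Rightarrow> space" where "vC t = ((t + 2, 0), 0)"
definition vE :: "real \<Rightarrow> space" where "vE t = ((t + 3, 0), 0)"
definition vB :: "real \<Rightarrow> real \<Rightarrow> space" where "vB t h = ((t + 2, 1), h)"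
lemmas v_defs = vF_def vA_def vD_def vC_def vE_def vB_def

definition hexagon :: "real \<Rightarrow> real \<Rightarrow> link" where
  "hexagon t h = {(vF t, vA t), (vA t, vB t h), (vB t h, vE t), (vE t, vC t), (vC t, vD t), (vD t, vF t)}"

text \<open>
  Eliminates the parameter of a point on a segment when it can be read off from the coordinates.
\<close>

lemma ex_param_iff:
  fixes w :: real
  assumes "\<And>u. P u \<Longrightarrow> u = w"
  shows "(\<exists>u. 0 \<le> u \<and> u \<le> 1 \<and> P u) \<longleftrightarrow> 0 \<le> w \<and> w \<le> 1 \<and> P w"
  using assms by blast

lemma hexagon_seg:
  "p \<in> seg (vF t, vA t) \<longleftrightarrow> snd (fst p) = 0 \<and> t \<le> fst (fst p) \<and> fst (fst p) \<le> t + 1 \<and> snd p = 0"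
  "p \<in> seg (vA t, vB t h) \<longleftrightarrow> fst (fst p) = t + 1 + snd (fst p) \<and> 0 \<le> snd (fst p) \<and> snd (fst p) \<le> 1 \<and> snd p = h * snd (fst p)"
  "p \<in> seg (vB t h, vE t) \<longleftrightarrow> fst (fst p) = t + 3 - snd (fst p) \<and> 0 \<le> snd (fst p) \<and> snd (fst p) \<le> 1 \<and> snd p = h * snd (fst p)"
  "p \<in> seg (vE t, vC t) \<longleftrightarrow> snd (fst p) = 0 \<and> t + 2 \<le> fst (fst p) \<and> fst (fst p) \<le> t + 3 \<and> snd p = 0"
  "p \<in> seg (vC t, vD t) \<longleftrightarrow> fst (fst p) = t + 2 - 2 * snd (fst p) \<and> 0 \<le> snd (fst p) \<and> snd (fst p) \<le> 1 \<and> snd p = 0"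
  "p \<in> seg (vD t, vF t) \<longleftrightarrow> fst (fst p) = t \<and> 0 \<le> snd (fst p) \<and> snd (fst p) \<le> 1 \<and> snd p = 0"
proof -
  show "p \<in> seg (vF t, vA t) \<longleftrightarrow> snd (fst p) = 0 \<and> t \<le> fst (fst p) \<and> fst (fst p) \<le> t + 1 \<and> snd p = 0"
    unfolding mem_space_seg by (subst ex_param_iff[where w = "fst (fst p) - t"]) (auto simp: v_defs algebra_simps)
  show "p \<in> seg (vA t, vB t h) \<longleftrightarrow> fst (fst p) = t + 1 + snd (fst p) \<and> 0 \<le> snd (fst p) \<and> snd (fst p) \<le> 1 \<and> snd p = h * snd (fst p)"
    unfolding mem_space_seg by (subst ex_param_iff[where w = "snd (fst p)"]) (auto simp: v_defs algebra_simps)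
  show "p \<in> seg (vB t h, vE t) \<longleftrightarrow> fst (fst p) = t + 3 - snd (fst p) \<and> 0 \<le> snd (fst p) \<and> snd (fst p) \<le> 1 \<and> snd p = h * snd (fst p)"
    unfolding mem_space_seg by (subst ex_param_iff[where w = "1 - snd (fst p)"]) (auto simp: v_defs algebra_simps)
  show "p \<in> seg (vE t, vC t) \<longleftrightarrow> snd (fst p) = 0 \<and> t + 2 \<le> fst (fst p) \<and> fst (fst p) \<le> t + 3 \<and> snd p = 0"
    unfolding mem_space_seg by (subst ex_param_iff[where w = "t + 3 - fst (fst p)"]) (auto simp: v_defs algebra_simps)
  show "p \<in> seg (vC t, vD t) \<longleftrightarrow> fst (fst p) = t + 2 - 2 * snd (fst p) \<and> 0 \<le> snd (fst p) \<and> snd (fst p) \<le> 1 \<and> snd p = 0"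
    unfolding mem_space_seg by (subst ex_param_iff[where w = "snd (fst p)"]) (auto simp: v_defs algebra_simps)
  show "p \<in> seg (vD t, vF t) \<longleftrightarrow> fst (fst p) = t \<and> 0 \<le> snd (fst p) \<and> snd (fst p) \<le> 1 \<and> snd p = 0"
    unfolding mem_space_seg by (subst ex_param_iff[where w = "1 - snd (fst p)"]) (auto simp: v_defs algebra_simps)
qed

lemma hexagon_proj_seg:
  "q \<in> seg (proj (vF t, vA t)) \<longleftrightarrow> snd q = 0 \<and> t \<le> fst q \<and> fst q \<le> t + 1"
  "q \<in> seg (proj (vA t, vB t h)) \<longleftrightarrow> fst q = t + 1 + snd q \<and> 0 \<le> snd q \<and> snd q \<le> 1"
  "q \<in> seg (proj (vB t h, vE t)) \<longleftrightarrow> fst q = t + 3 - snd q \<and> 0 \<le> snd q \<and> snd q \<le> 1"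
  "q \<in> seg (proj (vE t, vC t)) \<longleftrightarrow> snd q = 0 \<and> t + 2 \<le> fst q \<and> fst q \<le> t + 3"
  "q \<in> seg (proj (vC t, vD t)) \<longleftrightarrow> fst q = t + 2 - 2 * snd q \<and> 0 \<le> snd q \<and> snd q \<le> 1"
  "q \<in> seg (proj (vD t, vF t)) \<longleftrightarrow> fst q = t \<and> 0 \<le> snd q \<and> snd q \<le> 1"
proof -
  show "q \<in> seg (proj (vF t, vA t)) \<longleftrightarrow> snd q = 0 \<and> t \<le> fst q \<and> fst q \<le> t + 1"
    unfolding proj_def mem_plane_seg by (subst ex_param_iff[where w = "fst q - t"]) (auto simp: v_defs algebra_simps)
  show "q \<in> seg (proj (vA t, vB t h)) \<longleftrightarrow> fst q = t + 1 + snd q \<and> 0 \<le> snd q \<and> snd q \<le> 1"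
    unfolding proj_def mem_plane_seg by (subst ex_param_iff[where w = "snd q"]) (auto simp: v_defs algebra_simps)
  show "q \<in> seg (proj (vB t h, vE t)) \<longleftrightarrow> fst q = t + 3 - snd q \<and> 0 \<le> snd q \<and> snd q \<le> 1"
    unfolding proj_def mem_plane_seg by (subst ex_param_iff[where w = "1 - snd q"]) (auto simp: v_defs algebra_simps)
  show "q \<in> seg (proj (vE t, vC t)) \<longleftrightarrow> snd q = 0 \<and> t + 2 \<le> fst q \<and> fst q \<le> t + 3"
    unfolding proj_def mem_plane_seg by (subst ex_param_iff[where w = "t + 3 - fst q"]) (auto simp: v_defs algebra_simps)
  show "q \<in> seg (proj (vC t, vD t)) \<longleftrightarrow> fst q = t + 2 - 2 * snd q \<and> 0 \<le> snd q \<and> snd q \<le> 1"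
    unfolding proj_def mem_plane_seg by (subst ex_param_iff[where w = "snd q"]) (auto simp: v_defs algebra_simps)
  show "q \<in> seg (proj (vD t, vF t)) \<longleftrightarrow> fst q = t \<and> 0 \<le> snd q \<and> snd q \<le> 1"
    unfolding proj_def mem_plane_seg by (subst ex_param_iff[where w = "1 - snd q"]) (auto simp: v_defs algebra_simps)
qed

lemma hexagon_regular_position: "regular_position (hexagon t h)"
  unfolding regular_position_def
proof (intro conjI ballI impI)
  fix e assume e: "e \<in> hexagon t h"
  then show "fst (fst e) \<noteq> fst (snd e)" by (auto simp: hexagon_def v_defs)
  fix f assume "f \<in> hexagon t h" "fst (fst e) \<in> seg (proj f)"
  with e show "fst e = fst f \<or> fst e = snd f"
    unfolding hexagon_def
    by (elim insertE emptyE; simp add: hexagon_proj_seg; simp add: v_defs)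
next
  fix e f g assume m: "e \<in> hexagon t h" "f \<in> hexagon t h" "g \<in> hexagon t h"
    and n: "e \<noteq> f \<and> e \<noteq> g \<and> f \<noteq> g"
  have False if "q \<in> seg (proj e)" "q \<in> seg (proj f)" "q \<in> seg (proj g)" for q
    using m n that unfolding hexagon_def
    by (elim insertE emptyE; simp add: hexagon_proj_seg)
  then show "seg (proj e) \<inter> seg (proj f) \<inter> seg (proj g) = {}" by blast
qed

text \<open>
  The edge \<open>AB\<close> rises (or falls) with \<open>h\<close> while \<open>CD\<close> stays at height \<open>0\<close>; their projections cross at
  \<open>(t + 4/3, 1/3)\<close>. Every other pair of projected edges meets only at common corners.
\<close>

lemma over_curl:
  "over (hexagon t 1) = {(proj (vA t, vB t 1), proj (vC t, vD t))}"
  "over (hexagon t (- 1)) = {(proj (vC t, vD t), proj (vA t, vB t (- 1)))}"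
proof -
  have pos: "e = (vA t, vB t 1) \<and> f = (vC t, vD t)"
    if "e \<in> hexagon t 1" "f \<in> hexagon t 1" "((x, y), z) \<in> seg e" "((x, y), w) \<in> seg f" "w < z" for e f x y z w
    using that unfolding hexagon_def
    by (elim insertE emptyE; simp add: hexagon_seg)
  have neg: "e = (vC t, vD t) \<and> f = (vA t, vB t (- 1))"
    if "e \<in> hexagon t (- 1)" "f \<in> hexagon t (- 1)" "((x, y), z) \<in> seg e" "((x, y), w) \<in> seg f" "w < z" for e f x y z w
    using that unfolding hexagon_def
    by (elim insertE emptyE; simp add: hexagon_seg)
  have over_eq: "over D = {(proj e, proj f) | e f. e \<in> D \<and> f \<in> D \<and>
     (\<exists>x y z w. ((x, y), z) \<in> seg e \<and> ((x, y), w) \<in> seg f \<and> w < z)}" for D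
    unfolding over_def by (simp add: Bex_def)
  have cross: "((t + 4/3, 1/3), h/3) \<in> seg (vA t, vB t h)" "((t + 4/3, 1/3), 0) \<in> seg (vC t, vD t)" for h
    by (simp_all add: hexagon_seg)
  have mem: "(vA t, vB t h) \<in> hexagon t h" "(vC t, vD t) \<in> hexagon t h" for h
    by (simp_all add: hexagon_def)
  show "over (hexagon t 1) = {(proj (vA t, vB t 1), proj (vC t, vD t))}"
  proof
    show "over (hexagon t 1) \<subseteq> {(proj (vA t, vB t 1), proj (vC t, vD t))}"
      unfolding over_eq using pos by blast
    have "1 / 3 > (0 :: real)" by simp
    then show "{(proj (vA t, vB t 1), proj (vC t, vD t))} \<subseteq> over (hexagon t 1)"
      unfolding over_eq using mem[of 1] cross(1)[of 1] cross(2) by blast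
  qed
  show "over (hexagon t (- 1)) = {(proj (vC t, vD t), proj (vA t, vB t (- 1)))}"
  proof
    show "over (hexagon t (- 1)) \<subseteq> {(proj (vC t, vD t), proj (vA t, vB t (- 1)))}"
      unfolding over_eq using neg by blast
    have "- 1 / 3 < (0 :: real)" by simp
    then show "{(proj (vC t, vD t), proj (vA t, vB t (- 1)))} \<subseteq> over (hexagon t (- 1))"
      unfolding over_eq using mem[of "-1"] cross(1)[of "-1"] cross(2) by blast
  qed
qed

lemma v_neq:
  "vF t \<noteq> vA t" "vA t \<noteq> vF t" "vF t \<noteq> vD t" "vD t \<noteq> vF t" "vA t \<noteq> vD t" "vD t \<noteq> vA t"
  "vB t h \<noteq> vA t" "vA t \<noteq> vB t h" "vB t h \<noteq> vD t" "vD t \<noteq> vB t h" "vB t h \<noteq> vF t" "vF t \<noteq> vB t h"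
  "vC t \<noteq> vD t" "vD t \<noteq> vC t" "vB t h \<noteq> vC t" "vC t \<noteq> vB t h" "vC t \<noteq> vF t" "vF t \<noteq> vC t"
  by (simp_all add: v_defs)

lemma v_right:
  "t \<le> fst (fst (vF t))" "t \<le> fst (fst (vA t))" "t \<le> fst (fst (vB t h))"
  "t \<le> fst (fst (vC t))" "t \<le> fst (fst (vD t))"
  by (simp_all add: v_defs)

text \<open>
  Room for the curl: the remaining components lie in the open half-space to the left of it.
\<close>

definition left_of :: "real \<Rightarrow> link \<Rightarrow> bool" where
  "left_of t R \<longleftrightarrow> (\<forall>f \<in> R. \<forall>p \<in> seg f. fst (fst p) < t)"

lemma left_ofD: "left_of t R \<Longrightarrow> f \<in> R \<Longrightarrow> p \<in> seg f \<Longrightarrow> fst (fst p) < t"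
  by (simp add: left_of_def)

lemma polygonal_std_triangle_Un:
  assumes R: "R = {} \<or> polygonal_link R"
    and left: "left_of t R"
  shows "polygonal_link (triangle (vF t) (vA t) (vD t) \<union> R)"
proof (rule polygonal_triangle_Un[OF _ R])
  show "\<not> collinear {vF t, vA t, vD t}"
    by (rule noncollinear_shadow) (simp add: v_defs)
  fix f assume f: "f \<in> R"
  have "t \<le> fst (fst p)" if "p \<in> convex hull {vF t, vA t, vD t}" for p
    using hull_halfspace[OF that, of "-1" 0 0 "- t"] by (auto simp: v_defs)
  then show "convex hull {vF t, vA t, vD t} \<inter> seg f = {}"
    using left_ofD[OF left f] by force
qed

text \<open>
  The curl of either sign is removable: starting from the triangle \<open>FAD\<close>, insert \<open>B\<close> between \<open>A\<close> and \<open>D\<close>, then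
  \<open>C\<close> between \<open>B\<close> and \<open>D\<close>, then \<open>E\<close> between \<open>B\<close> and \<open>C\<close>. Linear
  inequalities separate the triangle of the move from the other edges up to common corners, except for
  \<open>AB\<close> against \<open>BDC\<close>, where the plane of the triangle is needed.
\<close>

lemma hexagon_unknot:
  assumes h: "h = 1 \<or> h = - 1" and R: "R = {} \<or> polygonal_link R"
    and left: "left_of t R"
  shows "polygonal_link (hexagon t h \<union> R) \<and> isotopic (triangle (vF t) (vA t) (vD t) \<union> R) (hexagon t h \<union> R)"
proof -
  have not_R: "R - {(v, w)} = R" if "t \<le> fst (fst v)" for v w
    using left_ofD[OF left, of "(v, w)" v] that by (auto simp: seg_def)
  let ?L1 = "triangle (vF t) (vA t) (vD t) \<union> R"
  let ?L2 = "{(vF t, vA t), (vA t, vB t h), (vB t h, vD t), (vD t, vF t)} \<union> R"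
  let ?L3 = "{(vF t, vA t), (vA t, vB t h), (vB t h, vC t), (vC t, vD t), (vD t, vF t)} \<union> R"
  let ?L4 = "hexagon t h \<union> R"
  have p1: "polygonal_link ?L1" by (rule polygonal_std_triangle_Un[OF R left])
  have 2: "polygonal_link ?L2 \<and> isotopic ?L1 ?L2"
  proof (rule insert_vertex[OF p1, where A = "vA t" and B = "vD t" and C = "vB t h"])
    show "(vA t, vD t) \<in> ?L1" by (simp add: triangle_def)
    show "\<not> collinear {vA t, vD t, vB t h}"
      by (rule noncollinear_shadow) (simp add: v_defs)
    show "?L2 = ?L1 - {(vA t, vD t)} \<union> {(vA t, vB t h), (vB t h, vD t)}"
      using not_R[of "vA t" "vD t"] by (simp add: triangle_def Un_Diff insert_Diff_if v_neq insert_commute v_right)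
    fix g p assume g: "g \<in> ?L1 - {(vA t, vD t)}" and p: "p \<in> convex hull {vA t, vD t, vB t h}" and pg: "p \<in> seg g"
    have c: "t + 1 \<le> fst (fst p) + snd (fst p)" "t \<le> fst (fst p)"
      using hull_halfspace[OF p, of "-1" "-1" 0 "- t - 1"] hull_halfspace[OF p, of "-1" 0 0 "- t"]
      by (auto simp: v_defs)
    consider "g = (vF t, vA t)" | "g = (vD t, vF t)" | "g \<in> R"
      using g by (auto simp: triangle_def)
    then show "p = vA t \<or> p = vD t"
    proof cases
      case 1 with pg hexagon_seg(1)[of p t] c show ?thesis by (simp add: v_defs prod_eq_iff)
    next
      case 2 with pg hexagon_seg(6)[of p t] c show ?thesis by (simp add: v_defs prod_eq_iff)
    next
      case 3 with pg left_ofD[OF left, of g p] c show ?thesis by simp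
    qed
  qed
  have 3: "polygonal_link ?L3 \<and> isotopic ?L2 ?L3"
  proof (rule insert_vertex[OF conjunct1[OF 2], where A = "vB t h" and B = "vD t" and C = "vC t"])
    show "(vB t h, vD t) \<in> ?L2" by simp
    show "\<not> collinear {vB t h, vD t, vC t}"
      by (rule noncollinear_shadow) (simp add: v_defs)
    show "?L3 = ?L2 - {(vB t h, vD t)} \<union> {(vB t h, vC t), (vC t, vD t)}"
      using not_R[of "vB t h" "vD t"] by (simp add: Un_Diff insert_Diff_if v_neq insert_commute v_right)
    fix g p assume g: "g \<in> ?L2 - {(vB t h, vD t)}" and p: "p \<in> convex hull {vB t h, vD t, vC t}" and pg: "p \<in> seg g"
    have c: "t + 2 \<le> fst (fst p) + 2 * snd (fst p)" "t \<le> fst (fst p)"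
      using hull_halfspace[OF p, of "-1" "-2" 0 "- t - 2"] hull_halfspace[OF p, of "-1" 0 0 "- t"]
      by (auto simp: v_defs)
    \<comment> \<open>the plane through \<open>B\<close>, \<open>C\<close>, \<open>D\<close>, which contains no point of \<open>AB\<close> but \<open>B\<close>\<close>
    have pl: "2 * snd p = h * (fst (fst p) + 2 * snd (fst p) - t - 2)"
      using hull_halfspace[OF p, of "h" "2*h" "-2" "h * (t + 2)"] hull_halfspace[OF p, of "-h" "-2*h" "2" "- h * (t + 2)"]
      by (auto simp: v_defs algebra_simps)
    consider "g = (vF t, vA t)" | "g = (vA t, vB t h)" | "g = (vD t, vF t)" | "g \<in> R"
      using g by auto
    then show "p = vB t h \<or> p = vD t"
    proof cases
      case 1 with pg hexagon_seg(1)[of p t] c show ?thesis by simp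
    next
      case 2
      with pg hexagon_seg(2)[of p t h] have a: "fst (fst p) = t + 1 + snd (fst p)" "snd p = h * snd (fst p)" by simp_all
      with pl h have "snd (fst p) = 1" by auto
      with a show ?thesis by (simp add: v_defs prod_eq_iff)
    next
      case 3 with pg hexagon_seg(6)[of p t] c show ?thesis by (simp add: v_defs prod_eq_iff)
    next
      case 4 with pg left_ofD[OF left, of g p] c show ?thesis by simp
    qed
  qed
  have 4: "polygonal_link ?L4 \<and> isotopic ?L3 ?L4"
  proof (rule insert_vertex[OF conjunct1[OF 3], where A = "vB t h" and B = "vC t" and C = "vE t"])
    show "(vB t h, vC t) \<in> ?L3" by simp
    show "\<not> collinear {vB t h, vC t, vE t}"
      by (rule noncollinear_shadow) (simp add: v_defs)
    show "?L4 = ?L3 - {(vB t h, vC t)} \<union> {(vB t h, vE t), (vE t, vC t)}"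
      using not_R[of "vB t h" "vC t"] by (simp add: hexagon_def Un_Diff insert_Diff_if v_neq insert_commute v_right)
    fix g p assume g: "g \<in> ?L3 - {(vB t h, vC t)}" and p: "p \<in> convex hull {vB t h, vC t, vE t}" and pg: "p \<in> seg g"
    have c: "t + 2 \<le> fst (fst p)"
      using hull_halfspace[OF p, of "-1" 0 0 "- t - 2"] by (auto simp: v_defs)
    consider "g = (vF t, vA t)" | "g = (vA t, vB t h)" | "g = (vC t, vD t)" | "g = (vD t, vF t)" | "g \<in> R"
      using g by auto
    then show "p = vB t h \<or> p = vC t"
    proof cases
      case 1 with pg hexagon_seg(1)[of p t] c show ?thesis by simp
    next
      case 2
      with pg hexagon_seg(2)[of p t h] have a: "fst (fst p) = t + 1 + snd (fst p)" "snd (fst p) \<le> 1"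
        "snd p = h * snd (fst p)" by simp_all
      with c have "snd (fst p) = 1" by simp
      with a show ?thesis by (simp add: v_defs prod_eq_iff)
    next
      case 3 with pg hexagon_seg(5)[of p t] c show ?thesis by (simp add: v_defs prod_eq_iff)
    next
      case 4 with pg hexagon_seg(6)[of p t] c show ?thesis by simp
    next
      case 5 with pg left_ofD[OF left, of g p] c show ?thesis by simp
    qed
  qed
  show ?thesis using 2 3 4 isotopic_trans by blast
qed

section \<open>The skein triple of an unlink\<close>

lemma std_unlink_Suc:
  "std_unlink (Suc m) = triangle (vF (2 * real m)) (vA (2 * real m)) (vD (2 * real m)) \<union> std_unlink m"
  by (simp add: std_unlink_def lessThan_Suc triangle_def Let_def v_defs)

lemma left_of_std_triangle_Un:
  assumes "left_of t R"
  shows "left_of (t + 2) (triangle (vF t) (vA t) (vD t) \<union> R)"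
  unfolding left_of_def
proof (intro ballI)
  fix f p assume f: "f \<in> triangle (vF t) (vA t) (vD t) \<union> R" and p: "p \<in> seg f"
  show "fst (fst p) < t + 2"
  proof (cases "f \<in> R")
    case True then show ?thesis using left_ofD[OF assms True p] by simp
  next
    case False
    have "p \<in> convex hull {fst f, snd f}"
      using p by (simp add: seg_def segment_convex_hull)
    from hull_halfspace[OF this, of 1 0 0 "t + 1"] f False show ?thesis
      by (auto simp: triangle_def v_defs)
  qed
qed

lemma std_unlink_left: "left_of (2 * real m) (std_unlink m)"
proof (induction m)
  case 0 then show ?case by (simp add: std_unlink_def left_of_def)
next
  case (Suc m)
  then show ?case
    using left_of_std_triangle_Un[OF Suc] by (simp add: std_unlink_Suc add.commute)
qed

lemma flat_std_unlink: "flat (std_unlink m)"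
  by (auto simp: flat_def std_unlink_def Let_def)

lemma std_unlink_empty_or_polygonal: "std_unlink m = {} \<or> polygonal_link (std_unlink m)"
proof (induction m)
  case 0 then show ?case by (simp add: std_unlink_def)
next
  case (Suc m)
  then show ?case
    using polygonal_std_triangle_Un[OF Suc std_unlink_left] by (simp add: std_unlink_Suc)
qed

lemma polygonal_std_unlink: "0 < r \<Longrightarrow> polygonal_link (std_unlink r)"
  using std_unlink_empty_or_polygonal[of r]
  by (cases r) (auto simp: std_unlink_Suc triangle_def)

text \<open>
  The triangle can be turned over within the half-space to the right of \<open>R\<close>, using the apex at height \<open>1\<close> over
  its corner \<open>F\<close> as the fourth point of the tetrahedron.
\<close>

lemma reversed_std_triangle:
  assumes R: "R = {} \<or> polygonal_link R"
    and left: "left_of t R"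
  shows "polygonal_link (triangle (vF t) (vD t) (vA t) \<union> R)"
    and "isotopic (triangle (vF t) (vD t) (vA t) \<union> R) (triangle (vF t) (vA t) (vD t) \<union> R)"
proof -
  let ?T = "((t, 0), 1) :: space"
  have nc: "\<not> collinear {vF t, vD t, vA t}"
    by (rule noncollinear_shadow) (simp add: v_defs)
  have away: "convex hull V \<inter> seg f = {}" if f: "f \<in> R" and V: "V \<subseteq> {vF t, vD t, vA t, ?T}" for f V
  proof -
    have "\<forall>v\<in>{vF t, vD t, vA t, ?T}. t \<le> fst (fst v)" by (simp add: v_defs)
    then have "\<forall>v\<in>V. t \<le> fst (fst v)" using V by blast
    then have "t \<le> fst (fst p)" if p: "p \<in> convex hull V" for p
      using hull_halfspace[OF p, of "-1" 0 0 "- t"] by simp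
    then show ?thesis using left_ofD[OF left f] by force
  qed
  show "polygonal_link (triangle (vF t) (vD t) (vA t) \<union> R)"
    by (rule polygonal_triangle_Un[OF nc R away]) auto
  have ad: "\<not> affine_dependent {vF t, vD t, vA t}"
    using nc by (simp add: collinear_3_eq_affine_dependent)
  have "affine hull {vF t, vD t, vA t} \<subseteq> {p. snd p = 0}"
  proof (rule hull_minimal)
    show "affine {p :: space. snd p = 0}" by (auto simp: affine_def)
  qed (auto simp: v_defs)
  then have "?T \<notin> affine hull {vF t, vD t, vA t}" by auto
  from affine_independent_insert[OF ad this]
  have ind: "\<not> affine_dependent {vF t, vD t, vA t, ?T}" by (simp add: insert_commute)
  have dist: "distinct [vF t, vD t, vA t, ?T]" by (simp add: v_defs)
  show "isotopic (triangle (vF t) (vD t) (vA t) \<union> R) (triangle (vF t) (vA t) (vD t) \<union> R)"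
    by (rule reverse_triangle[OF ind dist R away]) auto
qed

lemma shadow_hexagon:
  "shadow (hexagon t h) = {((t, 0), (t + 1, 0)), ((t + 1, 0), (t + 2, 1)), ((t + 2, 1), (t + 3, 0)),
     ((t + 3, 0), (t + 2, 0)), ((t + 2, 0), (t, 1)), ((t, 1), (t, 0))}"
  by (simp add: shadow_def hexagon_def proj_def v_defs)

text \<open>
  The two curls and the pair of triangles form a skein triple. The quadrilateral spanned by the crossing lies
  in the strip \<open>t + 1 \<le> x + y\<close>, \<open>x \<le> t + 2\<close>, whose boundary carries the four corners, and the remaining four
  edges of the hexagon lie on or beyond that boundary.
\<close>

lemma skein_triple_curl:
  assumes R: "R = {} \<or> polygonal_link R" and fl: "flat R"
    and left: "left_of t R"
  shows "skein_triple (hexagon t 1 \<union> R) (hexagon t (- 1) \<union> R)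
    (triangle (vF (t + 2)) (vD (t + 2)) (vA (t + 2)) \<union> (triangle (vF t) (vA t) (vD t) \<union> R))"
    (is "skein_triple ?Lp ?Lm ?L0")
proof -
  have left_proj: "fst q < t" if "f \<in> R" "q \<in> seg (proj f)" for f q
    using left_ofD[OF left that(1)] that(2) unfolding seg_proj by blast
  have right_proj: "t \<le> fst q" if "e \<in> hexagon t h" "q \<in> seg (proj e)" for e q h
    using that unfolding hexagon_def by (elim insertE emptyE; simp add: hexagon_proj_seg)
  have sep: "\<forall>e \<in> hexagon t h. \<forall>f \<in> R. seg (proj e) \<inter> seg (proj f) = {}" for h
    using right_proj left_proj by (meson disjoint_iff not_le)
  have reg: "regular_position R"
  proof (cases "R = {}")
    case True then show ?thesis by (simp add: regular_position_def)
  next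
    case False then show ?thesis using R fl flat_regular_position by blast
  qed
  have diag: "is_diagram (hexagon t h \<union> R)" if "h = 1 \<or> h = - 1" for h
    unfolding is_diagram_iff
    using hexagon_unknot[OF that R left] regular_position_Un[OF hexagon_regular_position reg sep] by blast
  have ov: "over (hexagon t h \<union> R) = over (hexagon t h)" for h
    using over_Un[OF sep] flat_over[OF fl] by simp
  have fl0: "flat ?L0" using fl by (auto simp: flat_def triangle_def v_defs)
  have poly0: "polygonal_link ?L0"
  proof (rule reversed_std_triangle)
    show "triangle (vF t) (vA t) (vD t) \<union> R = {} \<or> polygonal_link (triangle (vF t) (vA t) (vD t) \<union> R)"
      using polygonal_std_triangle_Un[OF R left] by blast
    show "left_of (t + 2) (triangle (vF t) (vA t) (vD t) \<union> R)"
      by (rule left_of_std_triangle_Un[OF left])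
  qed
  have diag0: "is_diagram ?L0"
    using poly0 flat_regular_position[OF poly0 fl0] by (simp add: is_diagram_iff)
  let ?A = "(t + 1, 0) :: plane" and ?B = "(t + 2, 1) :: plane"
    and ?C = "(t + 2, 0) :: plane" and ?D = "(t, 1) :: plane"
  let ?e = "(?A, ?B)" and ?f = "(?C, ?D)"
  have pe: "proj (vA t, vB t h) = ?e" and pf: "proj (vC t, vD t) = ?f" for h
    by (simp_all add: proj_def v_defs)
  have shR: "(v, w) \<notin> shadow R" if "t \<le> fst v" for v w
  proof
    assume "(v, w) \<in> shadow R"
    then obtain g where "g \<in> R" "proj g = (v, w)" by (auto simp: shadow_def)
    then show False using left_proj[of g v] that by (simp add: seg_def)
  qed
  have sh: "shadow (hexagon t h \<union> R) = shadow (hexagon t 1) \<union> shadow R" for h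
    by (simp add: shadow_hexagon shadow_def[of "_ \<union> _"] image_Un flip: shadow_def)
  have shR': "shadow R - {?e, ?f} = shadow R"
    using shR by auto
  have sh0: "shadow ?L0 = shadow ?Lp - {?e, ?f} \<union> {(?A, ?D), (?C, ?B)}"
  proof -
    have "vA (t + 2) = ((t + 3, 0), 0)" by (simp add: vA_def)
    then have L0: "shadow ?L0 = {(?C, ?B), (?B, (t + 3, 0)), ((t + 3, 0), ?C)} \<union>
       ({((t, 0), ?A), (?A, ?D), (?D, (t, 0))} \<union> shadow R)"
      by (simp add: shadow_def triangle_def proj_def image_Un vF_def vD_def vA_def[of t])
    have Lp: "shadow (hexagon t 1) - {?e, ?f} = {((t, 0), ?A), (?B, (t + 3, 0)), ((t + 3, 0), ?C), (?D, (t, 0))}"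
      by (simp add: shadow_hexagon insert_Diff_if)
    have perm: "{a, b, c} \<union> ({d, e, f} \<union> S) = {d, b, c, f} \<union> S \<union> {e, a}"
      for a b c d e f and S :: "(plane \<times> plane) set"
      by blast
    show ?thesis
      unfolding L0 sh Un_Diff shR' Lp by (rule perm)
  qed
  have iso: "isolated (shadow ?Lp) ?e ?f"
    unfolding isolated_def
  proof (intro ballI subsetI)
    fix g q assume g: "g \<in> shadow ?Lp - {?e, ?f}"
      and q: "q \<in> convex hull {fst ?e, snd ?e, fst ?f, snd ?f} \<inter> seg g"
    then have h: "q \<in> convex hull {?A, ?B, ?C, ?D}" by simp
    have c: "t + 1 \<le> fst q + snd q" "fst q \<le> t + 2" "t \<le> fst q"
      using plane_hull_halfspace[OF h, of "-1" "-1" "- t - 1"] plane_hull_halfspace[OF h, of 1 0 "t + 2"]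
        plane_hull_halfspace[OF h, of "-1" 0 "- t"] by simp_all
    consider "g = proj (vF t, vA t)" | "g = proj (vB t 1, vE t)" | "g = proj (vE t, vC t)"
      | "g = proj (vD t, vF t)" | "g \<in> shadow R"
      using g unfolding sh shadow_hexagon by (auto simp: proj_def v_defs)
    then show "q \<in> {fst ?e, snd ?e, fst ?f, snd ?f}"
    proof cases
      case 1
      then have "q = ?A" using q c by (simp add: hexagon_proj_seg) (simp add: prod_eq_iff)
      then show ?thesis by simp
    next
      case 2
      then have "q = ?B" using q c by (simp add: hexagon_proj_seg) (simp add: prod_eq_iff)
      then show ?thesis by simp
    next
      case 3
      then have "q = ?C" using q c by (simp add: hexagon_proj_seg) (simp add: prod_eq_iff)
      then show ?thesis by simp
    next
      case 4
      then have "q = ?D" using q c by (simp add: hexagon_proj_seg) (simp add: prod_eq_iff)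
      then show ?thesis by simp
    next
      case 5
      then obtain f where "f \<in> R" "g = proj f" by (auto simp: shadow_def)
      then show ?thesis using q c left_proj[of f q] by simp
    qed
  qed
  have pos: "positive_crossing ?e ?f" by (simp add: positive_crossing_def Let_def)
  have "over ?Lp = {(?e, ?f)}" "over ?Lm = {(?f, ?e)}" "over ?L0 = {}"
    using over_curl[of t] flat_over[OF fl0] by (simp_all only: ov pe pf)
  moreover have "shadow ?Lm = shadow ?Lp" by (simp only: sh)
  ultimately show ?thesis
    unfolding skein_triple_def Let_def
    using diag[of 1] diag[of "-1"] diag0 pos iso sh0
    by (intro conjI exI[of _ ?A] exI[of _ ?B] exI[of _ ?C] exI[of _ ?D]) simp_all
qed

text \<open>
  The curl is put into the last of the \<open>m + 1\<close> standard triangles. After smoothing, the two triangles are the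
  last two of the standard unlink with one more component, up to the orientation of the last one.
\<close>

lemma unlink_skein:
  "\<exists>Lp Lm L0. skein_triple Lp Lm L0 \<and> is_unlink (Suc m) Lp \<and> is_unlink (Suc m) Lm \<and> is_unlink (Suc (Suc m)) L0"
proof -
  let ?t = "2 * real m" and ?R = "std_unlink m"
  note R = std_unlink_empty_or_polygonal[of m] and left = std_unlink_left[of m]
  have "isotopic (std_unlink (Suc m)) (hexagon ?t h \<union> ?R)" if "h = 1 \<or> h = - 1" for h
    using hexagon_unknot[OF that R left] by (simp add: std_unlink_Suc)
  then have 1: "is_unlink (Suc m) (hexagon ?t h \<union> ?R)" if "h = 1 \<or> h = - 1" for h
    using that by (auto simp: is_unlink_def intro: isotopic_sym)
  have t: "2 * real (Suc m) = ?t + 2" by simp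
  have "isotopic (triangle (vF (?t + 2)) (vD (?t + 2)) (vA (?t + 2)) \<union> std_unlink (Suc m)) (std_unlink (Suc (Suc m)))"
    using reversed_std_triangle(2)[OF std_unlink_empty_or_polygonal[of "Suc m"] std_unlink_left[of "Suc m"]]
    unfolding std_unlink_Suc[of "Suc m"] t by blast
  then have 2: "is_unlink (Suc (Suc m)) (triangle (vF (?t + 2)) (vD (?t + 2)) (vA (?t + 2))
      \<union> (triangle (vF ?t) (vA ?t) (vD ?t) \<union> ?R))"
    by (simp add: is_unlink_def std_unlink_Suc[of m])
  show ?thesis
    using skein_triple_curl[OF R flat_std_unlink left] 1[of 1] 1[of "-1"] 2 by blast
qed

section \<open>Coefficients of Laurent polynomials\<close>

lemma lookup_monom_mult:
  "Poly_Mapping.lookup (monom_az i j * p) (i + k, j + l) = Poly_Mapping.lookup p (k, l)"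
proof -
  have *: "(x = y + q) = (q = x - y)" for x y q :: "int \<times> int" by (auto simp: algebra_simps)
  have "Poly_Mapping.lookup (monom_az i j * p) (i + k, j + l) =
     (\<Sum>m. ((\<Sum>q. Poly_Mapping.lookup p q when q = (i + k, j + l) - m) when m = (i, j)))"
    unfolding monom_az_def lookup_mult lookup_single
    by (intro Sum_any.cong) (auto simp: when_def *)
  then show ?thesis by simp
qed

lemma lookup_z_coeff: "Poly_Mapping.lookup (z_coeff d p) i = Poly_Mapping.lookup p (i, d)"
  unfolding z_coeff_def by (subst map_key.rep_eq) (auto simp: inj_def)

text \<open>
  A bound on the \<open>z\<close>-degree that also makes sense for the zero polynomial and need not be attained.
\<close>

definition z_degree_at_most :: "laurent_az \<Rightarrow> int \<Rightarrow> bool" where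
  "z_degree_at_most p n \<longleftrightarrow> (\<forall>i j. j > n \<longrightarrow> Poly_Mapping.lookup p (i, j) = 0)"

text \<open>
  The invariant of the induction over skein trees. The coefficient may vanish: the bound \<open>n\<close> stands for the
  depth of a tree, which the \<open>z\<close>-degree need not reach.
\<close>

definition top_is_monomial :: "laurent_az \<Rightarrow> nat \<Rightarrow> bool" where
  "top_is_monomial p n \<longleftrightarrow> z_degree_at_most p (int n) \<and> (z_coeff (int n) p = 0 \<or> z_coeff (int n) p \<in> M_set n)"

text \<open>
  One resolution, for both signs \<open>s\<close> of the crossing at once: \<open>p'\<close> is the polynomial at the node, \<open>p\<close> that of
  the switched and \<open>p0\<close> that of the smoothed diagram.
\<close>

lemma top_is_monomial_step:
  assumes 1: "z_degree_at_most p (int n)" and 0: "top_is_monomial p0 n" and s: "s = 1 \<or> s = -1"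
    and eq: "\<And>i j. Poly_Mapping.lookup p' (i, j) =
        Poly_Mapping.lookup p (i + 2 * s, j) + s * Poly_Mapping.lookup p0 (i + s, j - 1)"
  shows "top_is_monomial p' (Suc n)"
proof -
  \<comment> \<open>The switched diagram has no term in \<open>z\<close> to the power \<open>n + 1\<close>.\<close>
  have co: "Poly_Mapping.lookup (z_coeff (int (Suc n)) p') i
     = s * Poly_Mapping.lookup (z_coeff (int n) p0) (i + s)" for i
    using 1 by (simp add: lookup_z_coeff eq z_degree_at_most_def)
  have "z_degree_at_most p' (int (Suc n))"
    using 1 0 by (simp add: eq z_degree_at_most_def top_is_monomial_def)
  moreover have "z_coeff (int (Suc n)) p' \<in> M_set (Suc n)" if m: "z_coeff (int n) p0 \<in> M_set n"
  proof -
    obtain q where q: "q \<le> n" "z_coeff (int n) p0 = Poly_Mapping.single (2 * int q - int n) ((-1) ^ q)"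
      using m by (auto simp: M_set_def)
    \<comment> \<open>Smoothing multiplies by \<open>a\<^sup>\<minus>\<^sup>1\<close> at a positive and by \<open>- a\<close> at a negative crossing; only the latter raises \<open>q\<close>.\<close>
    define q' where "q' = (if s = 1 then q else Suc q)"
    have "z_coeff (int (Suc n)) p' = Poly_Mapping.single (2 * int q' - int (Suc n)) ((-1) ^ q')"
      by (rule poly_mapping_eqI, subst co) (use s in \<open>auto simp: q lookup_single when_def q'_def\<close>)
    moreover have "q' \<le> Suc n" using q by (auto simp: q'_def)
    ultimately show ?thesis by (auto simp: M_set_def)
  qed
  moreover have "z_coeff (int (Suc n)) p' = 0" if "z_coeff (int n) p0 = 0"
    by (rule poly_mapping_eqI, subst co) (use that in simp)
  ultimately show ?thesis using 0 by (auto simp: top_is_monomial_def)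
qed

section \<open>The HOMFLY--PT polynomial of an unlink\<close>

lemma HOMFLY_invariant:
  "is_HOMFLY P \<Longrightarrow> polygonal_link L \<Longrightarrow> polygonal_link L' \<Longrightarrow> isotopic L L' \<Longrightarrow> P L = P L'"
  unfolding is_HOMFLY_def by blast

lemma skein_coefficients:
  assumes "is_HOMFLY P" "skein_triple Lp Lm L0"
  shows "Poly_Mapping.lookup (P Lp) (i - 1, j) - Poly_Mapping.lookup (P Lm) (i + 1, j) =
         Poly_Mapping.lookup (P L0) (i, j - 1)"
proof -
  have "monom_az 1 0 * P Lp - monom_az (-1) 0 * P Lm = monom_az 0 1 * P L0"
    using assms unfolding is_HOMFLY_def by blast
  then have "Poly_Mapping.lookup (monom_az 1 0 * P Lp) (i, j)
      - Poly_Mapping.lookup (monom_az (-1) 0 * P Lm) (i, j)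
      = Poly_Mapping.lookup (monom_az 0 1 * P L0) (i, j)"
    by (metis lookup_minus)
  then show ?thesis
    using lookup_monom_mult[of 1 0 "P Lp" "i - 1" j]
      lookup_monom_mult[of "-1" 0 "P Lm" "i + 1" j] lookup_monom_mult[of 0 1 "P L0" i "j - 1"]
    by simp
qed

lemma is_diagramD: "is_diagram D \<Longrightarrow> polygonal_link D" by (simp add: is_diagram_def)

lemma HOMFLY_unlink:
  assumes P: "is_HOMFLY P" and "polygonal_link L" "is_unlink r L"
  shows "P L = P (std_unlink r)"
  using assms polygonal_std_unlink by (auto intro!: HOMFLY_invariant[OF P] simp: is_unlink_def)

text \<open>
  In the skein relation of \<open>unlink_skein\<close> both terms on the left are the polynomial of the smaller unlink, so
  \<open>z\<close> times the polynomial of the larger unlink has no higher \<open>z\<close>-degree than that of the smaller one.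
\<close>

lemma std_unlink_z_degree_at_most:
  assumes P: "is_HOMFLY P"
  shows "z_degree_at_most (P (std_unlink (Suc m))) (- int m)"
proof (induction m)
  case 0
  have "P (std_unlink 1) = 1"
    using P by (simp add: is_HOMFLY_def is_unlink_def isotopic_def)
  then show ?case by (simp add: z_degree_at_most_def lookup_one when_def zero_prod_def)
next
  case (Suc m)
  obtain Lp Lm L0 where t: "skein_triple Lp Lm L0" and u: "is_unlink (Suc m) Lp"
     "is_unlink (Suc m) Lm" "is_unlink (Suc (Suc m)) L0"
    using unlink_skein by blast
  have "polygonal_link Lp" "polygonal_link Lm" "polygonal_link L0"
    using t by (auto simp: skein_triple_def is_diagramD)
  then have e: "P Lp = P (std_unlink (Suc m))" "P Lm = P (std_unlink (Suc m))"
    "P L0 = P (std_unlink (Suc (Suc m)))"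
    using u by (auto intro: HOMFLY_unlink[OF P])
  have "Poly_Mapping.lookup (P (std_unlink (Suc (Suc m)))) (i, j) = 0" if "j > - int (Suc m)" for i j
    using skein_coefficients[OF P t, of i "j + 1"] that Suc
    by (simp add: e z_degree_at_most_def)
  then show ?case by (simp add: z_degree_at_most_def)
qed

section \<open>Skein trees\<close>

text \<open>
  The leaves of a skein tree satisfy the invariant for every \<open>n\<close>. The coefficient is nonzero only
  for \<open>n = 0\<close> and the unknot, where it is \<open>1\<close>.
\<close>

lemma unlink_top_is_monomial:
  assumes P: "is_HOMFLY P" and D: "polygonal_link D" "is_unlink r D"
  shows "top_is_monomial (P D) n"
proof (cases r)
  case 0 then show ?thesis using D by (simp add: is_unlink_def)
next
  case (Suc m)
  have b: "z_degree_at_most (P D) (- int m)"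
    using std_unlink_z_degree_at_most[OF P, of m] HOMFLY_unlink[OF P D] Suc by simp
  show ?thesis
  proof (cases "n = 0 \<and> m = 0")
    case True
    then have "P D = 1" using D Suc P by (simp add: is_HOMFLY_def)
    then have "z_coeff (int n) (P D) = Poly_Mapping.single 0 1"
      using True by (intro poly_mapping_eqI)
        (auto simp: lookup_z_coeff lookup_one lookup_single when_def zero_prod_def)
    then show ?thesis using b True by (auto simp: top_is_monomial_def M_set_def)
  next
    case False
    have "z_coeff (int n) (P D) = 0"
      by (rule poly_mapping_eqI) (use b False in \<open>auto simp: lookup_z_coeff z_degree_at_most_def\<close>)
    moreover have "z_degree_at_most (P D) (int n)" using b by (auto simp: z_degree_at_most_def)
    ultimately show ?thesis by (simp add: top_is_monomial_def)
  qed
qed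

lemma diagram_equiv_imp_isotopic: "diagram_equiv D D' \<Longrightarrow> isotopic D D'"
  unfolding diagram_equiv_def isotopic_def
  by (induction rule: equivclp_induct) (auto intro: equivclp_into_equivclp)

lemma valid_tree_root: "valid_tree T \<Longrightarrow> is_diagram (root T)"
  by (cases T) (auto simp: resolution_def skein_triple_def)

text \<open>
  The depth is only bounded by \<open>n\<close>, so that the invariant is available with the same \<open>n\<close> for both subtrees,
  whose depths may differ.
\<close>

lemma tree_top_is_monomial:
  assumes P: "is_HOMFLY P"
  shows "valid_tree T \<Longrightarrow> depth T \<le> n \<Longrightarrow> top_is_monomial (P (root T)) n"
proof (induction T arbitrary: n)
  case (Leaf D)
  then show ?case using unlink_top_is_monomial[OF P] is_diagramD by auto
next
  case (Node D S T)
  then obtain m where n: "n = Suc m" and d: "depth S \<le> m" "depth T \<le> m"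
    by (cases n) auto
  obtain D\<^sub>1 D\<^sub>0 where r: "resolution D D\<^sub>1 D\<^sub>0"
    and e: "diagram_equiv D\<^sub>1 (root S)" "diagram_equiv D\<^sub>0 (root T)"
    using Node.prems by auto
  have v: "valid_tree S" "valid_tree T" using Node.prems by auto
  have pl: "polygonal_link D\<^sub>1" "polygonal_link D\<^sub>0"
    using r by (auto simp: resolution_def skein_triple_def is_diagramD)
  have "P D\<^sub>1 = P (root S)" "P D\<^sub>0 = P (root T)"
    using HOMFLY_invariant[OF P] pl e v
    by (simp_all add: diagram_equiv_imp_isotopic valid_tree_root is_diagramD)
  then have ok: "z_degree_at_most (P D\<^sub>1) (int m)" "top_is_monomial (P D\<^sub>0) m"
    using Node.IH v d by (auto simp: top_is_monomial_def)
  from r have "top_is_monomial (P D) (Suc m)"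
    unfolding resolution_def
  proof
    assume t: "skein_triple D D\<^sub>1 D\<^sub>0"
    show ?thesis
    proof (rule top_is_monomial_step[OF ok, of 1])
      show "Poly_Mapping.lookup (P D) (i, j) =
        Poly_Mapping.lookup (P D\<^sub>1) (i + 2 * 1, j) + 1 * Poly_Mapping.lookup (P D\<^sub>0) (i + 1, j - 1)" for i j
        using skein_coefficients[OF P t, of "i + 1" j] by (simp add: algebra_simps)
    qed simp
  next
    assume t: "skein_triple D\<^sub>1 D D\<^sub>0"
    show ?thesis
    proof (rule top_is_monomial_step[OF ok, of "-1"])
      show "Poly_Mapping.lookup (P D) (i, j) =
        Poly_Mapping.lookup (P D\<^sub>1) (i + 2 * -1, j) + -1 * Poly_Mapping.lookup (P D\<^sub>0) (i + -1, j - 1)" for i j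
        using skein_coefficients[OF P t, of "i - 1" j] by (simp add: algebra_simps)
    qed simp
  qed
  then show ?case by (simp add: n)
qed

theorem theorem3p1:
  fixes P :: "link \<Rightarrow> laurent_az" and L :: link and d :: nat
  assumes "is_HOMFLY P"
    and "polygonal_link L"
    and "is_z_degree (P L) (int d)"
  shows "((\<exists>T. skein_tree_for L T \<and> depth T = d) \<longrightarrow> z_coeff (int d) (P L) \<in> M_set d) \<and>
         (z_coeff (int d) (P L) \<notin> M_set d \<longrightarrow> td L \<ge> enat (d + 1))"
proof -
  have nz: "z_coeff (int d) (P L) \<noteq> 0"
    using assms(3) by (force simp: is_z_degree_def lookup_z_coeff poly_mapping_eq_iff fun_eq_iff in_keys_iff)
  have *: "z_coeff (int d) (P L) \<in> M_set d" if T: "skein_tree_for L T" "depth T \<le> d" for T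
  proof -
    have "P L = P (root T)"
      using T assms by (intro HOMFLY_invariant) (auto simp: skein_tree_for_def diagram_of_def is_diagramD)
    then show ?thesis
      using tree_top_is_monomial[OF assms(1) _ T(2)] T(1) nz by (simp add: skein_tree_for_def top_is_monomial_def)
  qed
  moreover have "td L \<ge> enat (d + 1)" if "z_coeff (int d) (P L) \<notin> M_set d"
    unfolding td_def
  proof (rule INF_greatest)
    fix T assume "T \<in> {T. skein_tree_for L T}"
    then show "enat (d + 1) \<le> enat (depth T)" using * that by (force simp: not_le)
  qed
  ultimately show ?thesis by blast
qed

end
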